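(* Let $C$ be a finite dimensional chain coalgebra over an algebraically closed field $K$. Then $C$ is isomorphic (as a coalgebra) to $K_n$ for some $n\in\mathbb{N}$.
   Context: A coalgebra $C$ over a field $K$ is a chain coalgebra if any two left subcomodules of $C$ are comparable under inclusion (this is equivalent to the same condition for right subcomodules). $\mathbb{N}=\{0,1,2,\dots\}$. $K_n$ denotes the coalgebra over $K$ with basis $c_0,c_1,\dots,c_{n-1}$, comultiplication $\Delta(c_k)=\sum_{i+j=k}c_i\otimes c_j$ and counit $\varepsilon(c_i)=\delta_{0,i}$ (so $K_0=0$). *)

theory Defs
  imports "HOL-Computational_Algebra.Polynomial" "HOL-Library.Function_Algebras"
begin

section \<open>Vector spaces with carrier\<close>

text \<open>
  A vector space is a subspace \<open>car V\<close> of an ambient vector space. The ambient space is a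
  type of class \<open>ab_group_add\<close> with scalar multiplication \<open>scl V\<close>. Carriers are needed because
  the dimension of the coalgebras \<open>K_coalg n\<close> below depends on the number \<open>n\<close>.
\<close>

record ('k, 'v) vs =
  car :: "'v set"
  scl :: "'k \<Rightarrow> 'v \<Rightarrow> 'v"

definition is_vs :: "('k::field, 'v::ab_group_add, 'm) vs_scheme \<Rightarrow> bool" where
  "is_vs V \<longleftrightarrow> vector_space (scl V) \<and> module.subspace (scl V) (car V)"

definition finite_dim :: "('k::field, 'v::ab_group_add, 'm) vs_scheme \<Rightarrow> bool" where
  "finite_dim V \<longleftrightarrow> (\<exists>B. finite B \<and> car V = module.span (scl V) B)"

definition ground :: "('k::field, 'k) vs" where
  "ground = \<lparr>car = UNIV, scl = (*)\<rparr>"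

definition linear_on ::
  "('k::field, 'v::ab_group_add, 'm) vs_scheme \<Rightarrow> ('k, 'w::ab_group_add, 'n) vs_scheme
    \<Rightarrow> ('v \<Rightarrow> 'w) \<Rightarrow> bool" where
  "linear_on V W f \<longleftrightarrow>
     (\<forall>x\<in>car V. f x \<in> car W) \<and>
     (\<forall>x\<in>car V. \<forall>y\<in>car V. f (x + y) = f x + f y) \<and>
     (\<forall>a. \<forall>x\<in>car V. f (scl V a x) = scl W a (f x))"

definition bilinear_on ::
  "('k::field, 'v::ab_group_add, 'm) vs_scheme \<Rightarrow> ('k, 'w::ab_group_add, 'n) vs_scheme
    \<Rightarrow> ('k, 'u::ab_group_add, 'o) vs_scheme \<Rightarrow> ('v \<Rightarrow> 'w \<Rightarrow> 'u) \<Rightarrow> bool" where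
  "bilinear_on V W U B \<longleftrightarrow>
     (\<forall>x\<in>car V. linear_on W U (B x)) \<and> (\<forall>y\<in>car W. linear_on V U (\<lambda>x. B x y))"

definition fscale :: "'k::field \<Rightarrow> ('i \<Rightarrow> 'k) \<Rightarrow> 'i \<Rightarrow> 'k" where
  "fscale a f = (\<lambda>i. a * f i)"


section \<open>Tensor products\<close>

text \<open>
  The tensor product of \<open>V\<close> and \<open>W\<close> is realised inside the dual of the space of bilinear forms
  on \<open>V \<times> W\<close>: the pure tensor \<open>x \<otimes> y\<close> is evaluation at \<open>(x, y)\<close>, and \<open>V \<otimes> W\<close> is the span of
  the pure tensors. The lemmas \<open>bilinear_tens\<close>, \<open>tensor_universal\<close> and \<open>tensor_universal_unique\<close>
  show that this is a tensor product, i.e. that it has the universal property for bilinear maps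
  into arbitrary vector spaces. Functionals take the junk value 0 at arguments that are not
  bilinear forms on the carriers, so that equality of tensors is equality of functions.
\<close>

definition tens ::
  "('k::field, 'v::ab_group_add, 'm) vs_scheme \<Rightarrow> ('k, 'w::ab_group_add, 'n) vs_scheme
    \<Rightarrow> 'v \<Rightarrow> 'w \<Rightarrow> ('v \<Rightarrow> 'w \<Rightarrow> 'k) \<Rightarrow> 'k" where
  "tens V W x y = (\<lambda>B. if bilinear_on V W ground B then B x y else 0)"

definition tensor ::
  "('k::field, 'v::ab_group_add, 'm) vs_scheme \<Rightarrow> ('k, 'w::ab_group_add, 'n) vs_scheme
    \<Rightarrow> ('k, ('v \<Rightarrow> 'w \<Rightarrow> 'k) \<Rightarrow> 'k) vs" where
  "tensor V W =
     \<lparr>car = module.span fscale {tens V W x y | x y. x \<in> car V \<and> y \<in> car W}, scl = fscale\<rparr>"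

text \<open>
  The map \<open>f \<otimes> g\<close> into the tensor product of \<open>V\<close> and \<open>W\<close>, which are the codomains
  of \<open>f\<close> and \<open>g\<close>; see \<open>tensor_map_tens\<close>.
\<close>

definition tensor_map ::
  "('k::field, 'v2::ab_group_add, 'm) vs_scheme \<Rightarrow> ('k, 'w2::ab_group_add, 'n) vs_scheme
    \<Rightarrow> ('v1 \<Rightarrow> 'v2) \<Rightarrow> ('w1 \<Rightarrow> 'w2) \<Rightarrow> (('v1 \<Rightarrow> 'w1 \<Rightarrow> 'k) \<Rightarrow> 'k) \<Rightarrow> ('v2 \<Rightarrow> 'w2 \<Rightarrow> 'k) \<Rightarrow> 'k" where
  "tensor_map V W f g t =
     (\<lambda>B. if bilinear_on V W ground B then t (\<lambda>x y. B (f x) (g y)) else 0)"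

text \<open>
  The canonical map from \<open>(U \<otimes> V) \<otimes> W\<close> to \<open>U \<otimes> (V \<otimes> W)\<close>; see \<open>tensor_assoc_tens\<close>.
\<close>

definition tensor_assoc ::
  "('k::field, 'u::ab_group_add, 'm) vs_scheme \<Rightarrow> ('k, 'v::ab_group_add, 'n) vs_scheme
    \<Rightarrow> ('k, 'w::ab_group_add, 'o) vs_scheme
    \<Rightarrow> (((('u \<Rightarrow> 'v \<Rightarrow> 'k) \<Rightarrow> 'k) \<Rightarrow> 'w \<Rightarrow> 'k) \<Rightarrow> 'k)
    \<Rightarrow> ('u \<Rightarrow> (('v \<Rightarrow> 'w \<Rightarrow> 'k) \<Rightarrow> 'k) \<Rightarrow> 'k) \<Rightarrow> 'k" where
  "tensor_assoc U V W t =
     (\<lambda>B. if bilinear_on U (tensor V W) ground B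
          then t (\<lambda>s z. s (\<lambda>x y. B x (tens V W y z))) else 0)"


section \<open>Coalgebras\<close>

record ('k, 'c) coalg = "('k, 'c) vs" +
  comult :: "'c \<Rightarrow> ('c \<Rightarrow> 'c \<Rightarrow> 'k) \<Rightarrow> 'k"
  counit :: "'c \<Rightarrow> 'k"

locale coalgebra =
  fixes C :: "('k::field, 'c::ab_group_add, 'm) coalg_scheme"
  assumes is_vs: "is_vs C"
    and comult_linear: "linear_on C (tensor C C) (comult C)"
    and counit_linear: "linear_on C ground (counit C)"
    and coassoc: "c \<in> car C \<Longrightarrow>
      tensor_assoc C C C (tensor_map (tensor C C) C (comult C) id (comult C c))
        = tensor_map C (tensor C C) id (comult C) (comult C c)"
    and counit_left: "c \<in> car C \<Longrightarrow>
      tensor_map ground C (counit C) id (comult C c) = tens ground C 1 c"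
    and counit_right: "c \<in> car C \<Longrightarrow>
      tensor_map C ground id (counit C) (comult C c) = tens C ground c 1"

text \<open>
  Left subcomodules of \<open>C\<close>, viewed as a left comodule over itself with coaction \<open>comult C\<close>,
  are the subspaces \<open>N\<close> that are mapped into \<open>C \<otimes> N\<close>. The latter is viewed as a
  subspace of \<open>C \<otimes> C\<close>.
\<close>

definition left_subcomodule ::
  "('k::field, 'c::ab_group_add, 'm) coalg_scheme \<Rightarrow> 'c set \<Rightarrow> bool" where
  "left_subcomodule C N \<longleftrightarrow>
     N \<subseteq> car C \<and> module.subspace (scl C) N \<and>
     comult C ` N \<subseteq> module.span fscale {tens C C x y | x y. x \<in> car C \<and> y \<in> N}"

locale chain_coalgebra = coalgebra +
  assumes chain: "left_subcomodule C M \<Longrightarrow> left_subcomodule C N \<Longrightarrow> M \<subseteq> N \<or> N \<subseteq> M"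

definition coalgebra_iso ::
  "('k::field, 'c::ab_group_add, 'm) coalg_scheme \<Rightarrow> ('k, 'd::ab_group_add, 'n) coalg_scheme
    \<Rightarrow> ('c \<Rightarrow> 'd) \<Rightarrow> bool" where
  "coalgebra_iso C D f \<longleftrightarrow>
     linear_on C D f \<and> bij_betw f (car C) (car D) \<and>
     (\<forall>c\<in>car C. comult D (f c) = tensor_map D D f f (comult C c)) \<and>
     (\<forall>c\<in>car C. counit D (f c) = counit C c)"

definition coalgebra_isomorphic ::
  "('k::field, 'c::ab_group_add, 'm) coalg_scheme \<Rightarrow> ('k, 'd::ab_group_add, 'n) coalg_scheme
    \<Rightarrow> bool" where
  "coalgebra_isomorphic C D \<longleftrightarrow> (\<exists>f. coalgebra_iso C D f)"


section \<open>The coalgebras \<open>K_coalg n\<close>\<close>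

definition K_vs :: "nat \<Rightarrow> ('k::field, nat \<Rightarrow> 'k) vs" where
  "K_vs n = \<lparr>car = {f. \<forall>i\<ge>n. f i = 0}, scl = fscale\<rparr>"

definition cvec :: "nat \<Rightarrow> nat \<Rightarrow> 'k::field" where
  "cvec k = (\<lambda>i. if i = k then 1 else 0)"

text \<open>
  Comultiplication and counit are the linear extensions of their prescribed values on the
  basis \<open>cvec 0, \<dots>, cvec (n - 1)\<close>; see \<open>K_comult_cvec\<close> and \<open>K_counit_cvec\<close>.
\<close>

definition K_coalg :: "nat \<Rightarrow> ('k::field, nat \<Rightarrow> 'k) coalg" where
  "K_coalg n =
     \<lparr>car = car (K_vs n), scl = fscale,
      comult = (\<lambda>f. \<Sum>k<n. fscale (f k)
                  (\<Sum>(i, j) \<in> {(i, j). i + j = k}. tens (K_vs n) (K_vs n) (cvec i) (cvec j))),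
      counit = (\<lambda>f. \<Sum>k<n. f k * (if k = 0 then 1 else 0))\<rparr>"


section \<open>Properties that validate the definitions\<close>

text \<open>
  As rewrite rules these would eta-expand the zero and the sum of tensors.
\<close>

declare zero_fun_apply [simp del] plus_fun_apply [simp del]

lemmas fun_apply = zero_fun_apply plus_fun_apply

global_interpretation fscale: vector_space "fscale :: 'k::field \<Rightarrow> ('i \<Rightarrow> 'k) \<Rightarrow> 'i \<Rightarrow> 'k"
  by standard (auto simp: fscale_def fun_eq_iff fun_apply algebra_simps)

lemma ground_simps [simp]: "car ground = UNIV" "scl ground = (*)"
  by (simp_all add: ground_def)

lemma scl_tensor [simp]: "scl (tensor V W) = fscale"
  by (simp add: tensor_def)

lemma is_vs_ground: "is_vs (ground :: ('a::field, 'a) vs)"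
proof -
  interpret vector_space "(*) :: 'a \<Rightarrow> 'a \<Rightarrow> 'a"
    by standard (auto simp: algebra_simps)
  show ?thesis
    by (simp add: is_vs_def vector_space_axioms)
qed

lemma is_vs_tensor: "is_vs (tensor V W)"
  by (simp add: is_vs_def tensor_def fscale.vector_space_axioms)

lemma tens_in_tensor: "x \<in> car V \<Longrightarrow> y \<in> car W \<Longrightarrow> tens V W x y \<in> car (tensor V W)"
  unfolding tensor_def by (auto intro: fscale.span_base)

lemma is_vs_closed:
  assumes "is_vs V"
  shows "x \<in> car V \<Longrightarrow> y \<in> car V \<Longrightarrow> x + y \<in> car V"
    and "x \<in> car V \<Longrightarrow> scl V a x \<in> car V" and "0 \<in> car V"
proof -
  interpret vector_space "scl V" using assms by (simp add: is_vs_def)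
  show "x \<in> car V \<Longrightarrow> y \<in> car V \<Longrightarrow> x + y \<in> car V"
    and "x \<in> car V \<Longrightarrow> scl V a x \<in> car V" and "0 \<in> car V"
    using assms by (auto simp: is_vs_def subspace_def)
qed

lemma bilinear_tens: "bilinear_on V W (tensor V W) (tens V W)"
  unfolding bilinear_on_def linear_on_def
  by (auto simp: tens_in_tensor)
     (auto simp: tens_def fun_eq_iff fun_apply fscale_def bilinear_on_def linear_on_def)

lemma tensor_linear_induct [consumes 1, case_names zero add]:
  assumes "t \<in> car (tensor V W)" "P 0"
    and "\<And>a x y s. x \<in> car V \<Longrightarrow> y \<in> car W \<Longrightarrow> s \<in> car (tensor V W) \<Longrightarrow> P s
           \<Longrightarrow> P (fscale a (tens V W x y) + s)"
  shows "P t"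
proof -
  have "t \<in> car (tensor V W) \<and> P t"
    using assms(1)[unfolded tensor_def vs.simps]
  proof (induction rule: fscale.span_induct_alt)
    case base
    then show ?case using assms(2) is_vs_closed(3)[OF is_vs_tensor] by blast
  next
    case (step c x y)
    then show ?case
      using assms(3) is_vs_closed(1,2)[OF is_vs_tensor] tens_in_tensor scl_tensor
      by (smt (verit, best) mem_Collect_eq)
  qed
  then show ?thesis ..
qed

lemma linear_on_zero:
  assumes "is_vs V" "linear_on V W f"
  shows "f 0 = 0"
proof -
  have "f (0 + 0) = f 0 + f 0"
    using assms is_vs_closed(3)[OF assms(1)] by (metis linear_on_def)
  then show ?thesis by simp
qed

lemma vs_separate:
  assumes "is_vs V" "x \<noteq> y"
  shows "\<exists>p. linear_on V ground p \<and> p x \<noteq> p y \<and> (\<forall>x y. p (x + y) = p x + p y)"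
proof -
  interpret vector_space "scl V" using assms by (simp add: is_vs_def)
  interpret g: vector_space "(*) :: 'a \<Rightarrow> 'a \<Rightarrow> 'a"
    by standard (auto simp: algebra_simps)
  interpret vector_space_pair "scl V" "(*) :: 'a \<Rightarrow> 'a \<Rightarrow> 'a" ..
  have "independent {x - y}" using assms by simp
  from linear_independent_extend[OF this, of "\<lambda>_. 1"]
  obtain p where p: "Vector_Spaces.linear (scl V) (*) p" "p (x - y) = 1" by auto
  interpret p: Vector_Spaces.linear "scl V" "(*)" p by fact
  have "p x \<noteq> p y" using p(2) by (auto simp: p.diff)
  then show ?thesis
    by (intro exI[of _ p]) (auto simp: linear_on_def p.add p.scale)
qed

theorem tensor_universal:
  assumes U: "is_vs U" and b: "bilinear_on V W U b"
  shows "\<exists>L. linear_on (tensor V W) U L \<and> (\<forall>x\<in>car V. \<forall>y\<in>car W. L (tens V W x y) = b x y)"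
proof -
  define R where "R t u \<longleftrightarrow> u \<in> car U \<and>
    (\<forall>p. linear_on U ground p \<longrightarrow> p u = t (\<lambda>x y. p (b x y)))" for t u
  interpret U: vector_space "scl U" using U by (simp add: is_vs_def)
  have bil: "bilinear_on V W ground (\<lambda>x y. p (b x y))" if "linear_on U ground p" for p
    using that b by (auto simp: bilinear_on_def linear_on_def)
  have uniq: "u = v" if "R t u" "R t v" for t u v
    using vs_separate[OF U, of u v] that unfolding R_def by metis
  have tensR: "R (tens V W x y) (b x y)" if "x \<in> car V" "y \<in> car W" for x y
    using that b bil by (auto simp: R_def tens_def bilinear_on_def linear_on_def)
  have addR: "R (s + t) (u + v)" if "R s u" "R t v" for s t u v
    using that is_vs_closed(1)[OF U] by (auto simp: R_def linear_on_def fun_apply)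
  have sclR: "R (fscale a t) (scl U a u)" if "R t u" for a t u
    using that is_vs_closed(2)[OF U] by (auto simp: R_def linear_on_def fscale_def fun_apply)
  have zeroR: "R 0 0"
  proof -
    have "p 0 = 0" if "linear_on U ground p" for p
      using linear_on_zero[OF U that] .
    then show ?thesis using is_vs_closed(3)[OF U] by (simp add: R_def fun_apply)
  qed
  have ex: "\<exists>u. R t u" if "t \<in> car (tensor V W)" for t
    using that
  proof (induction rule: tensor_linear_induct)
    case zero
    then show ?case using zeroR by blast
  next
    case (add a x y s)
    then show ?case using addR[OF sclR[OF tensR]] by blast
  qed
  define L where "L t = (SOME u. R t u)" for t
  have LR: "R t (L t)" if "t \<in> car (tensor V W)" for t
    using ex[OF that] unfolding L_def by (rule someI_ex)
  have "linear_on (tensor V W) U L"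
    unfolding linear_on_def
  proof (intro conjI ballI allI)
    fix s t a assume s: "s \<in> car (tensor V W)"
    show "L s \<in> car U" using LR[OF s] by (simp add: R_def)
    show "L (scl (tensor V W) a s) = scl U a (L s)"
      using LR[OF is_vs_closed(2)[OF is_vs_tensor s], of a] sclR[OF LR[OF s], of a] uniq
      by (metis scl_tensor)
    assume t: "t \<in> car (tensor V W)"
    show "L (s + t) = L s + L t"
      using LR[OF is_vs_closed(1)[OF is_vs_tensor s t]] addR[OF LR[OF s] LR[OF t]] uniq by auto
  qed
  moreover have "L (tens V W x y) = b x y" if "x \<in> car V" "y \<in> car W" for x y
    using LR[OF tens_in_tensor[OF that]] tensR[OF that] uniq by auto
  ultimately show ?thesis by blast
qed

lemma tensor_universal_unique:
  assumes "linear_on (tensor V W) U L" "linear_on (tensor V W) U M"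
    and eq: "\<And>x y. x \<in> car V \<Longrightarrow> y \<in> car W \<Longrightarrow> L (tens V W x y) = M (tens V W x y)"
    and t: "t \<in> car (tensor V W)"
  shows "L t = M t"
  using t
proof (induction rule: tensor_linear_induct)
  case zero
  show ?case
    using linear_on_zero[OF is_vs_tensor assms(1)] linear_on_zero[OF is_vs_tensor assms(2)] by simp
next
  case (add a x y s)
  have *: "fscale a (tens V W x y) \<in> car (tensor V W)"
    using is_vs_closed(2)[OF is_vs_tensor tens_in_tensor] add by (metis scl_tensor)
  show ?case
    using assms(1,2) add * tens_in_tensor[OF add(1,2)] eq
    by (simp add: linear_on_def)
qed

lemma tensor_map_linear [simp]:
  "tensor_map V W f g 0 = 0"
  "tensor_map V W f g (s + t) = tensor_map V W f g s + tensor_map V W f g t"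
  "tensor_map V W f g (fscale a t) = fscale a (tensor_map V W f g t)"
  by (auto simp: tensor_map_def fun_eq_iff fun_apply fscale_def fun_apply)

lemma bilinear_on_comp:
  assumes "linear_on V V' f" "linear_on W W' g" "bilinear_on V' W' U B"
  shows "bilinear_on V W U (\<lambda>x y. B (f x) (g y))"
  using assms by (auto simp: bilinear_on_def linear_on_def)

lemma tensor_map_tens:
  assumes "linear_on V V' f" "linear_on W W' g"
  shows "tensor_map V' W' f g (tens V W x y) = tens V' W' (f x) (g y)"
  using bilinear_on_comp[OF assms, of ground] by (auto simp: tensor_map_def tens_def fun_eq_iff fun_apply)

lemma tensor_apply_linear:
  assumes "t \<in> car (tensor V W)" "bilinear_on V W ground A" "bilinear_on V W ground B"
  shows "t (\<lambda>x y. A x y + B x y) = t A + t B" "t (\<lambda>x y. a * A x y) = a * t A"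
proof -
  have *: "bilinear_on V W ground (\<lambda>x y. A x y + B x y)" "bilinear_on V W ground (\<lambda>x y. a * A x y)"
    using assms(2,3) by (auto simp: bilinear_on_def linear_on_def algebra_simps)
  show "t (\<lambda>x y. A x y + B x y) = t A + t B"
    using assms(1) by (induction rule: tensor_linear_induct)
      (use assms(2,3) * in \<open>auto simp: tens_def fscale_def fun_apply algebra_simps\<close>)
  show "t (\<lambda>x y. a * A x y) = a * t A"
    using assms(1) by (induction rule: tensor_linear_induct)
      (use assms(2,3) * in \<open>auto simp: tens_def fscale_def fun_apply algebra_simps\<close>)
qed

lemma tensor_assoc_linear [simp]:
  "tensor_assoc U V W 0 = 0"
  "tensor_assoc U V W (s + t) = tensor_assoc U V W s + tensor_assoc U V W t"
  "tensor_assoc U V W (fscale a t) = fscale a (tensor_assoc U V W t)"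
  by (auto simp: tensor_assoc_def fun_eq_iff fun_apply fscale_def fun_apply)

lemma tensor_assoc_tens:
  fixes U :: "('a::field, 'd::ab_group_add, 'm) vs_scheme"
    and V :: "('a, 'e::ab_group_add, 'n) vs_scheme"
    and W :: "('a, 'f::ab_group_add, 'o) vs_scheme"
  assumes "is_vs W" "x \<in> car U" "y \<in> car V" "z \<in> car W"
  shows "tensor_assoc U V W (tens (tensor U V) W (tens U V x y) z)
           = tens U (tensor V W) x (tens V W y z)"
proof
  fix B
  show "tensor_assoc U V W (tens (tensor U V) W (tens U V x y) z) B
           = tens U (tensor V W) x (tens V W y z) B"
  proof (cases "bilinear_on U (tensor V W) ground B")
    case True
    have lin1: "linear_on V (tensor V W) (\<lambda>y. tens V W y z)" if "z \<in> car W" for z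
      using bilinear_tens[of V W] that by (simp add: bilinear_on_def)
    have bz: "bilinear_on U V ground (\<lambda>x y. B x (tens V W y z))" if "z \<in> car W" for z
      by (rule bilinear_on_comp[OF _ lin1[OF that] True, of U "\<lambda>x. x"]) (simp add: linear_on_def)
    have lin2: "B x (tens V W y (z + z')) = B x (tens V W y z) + B x (tens V W y z')"
      "B x (tens V W y (scl W a z)) = a * B x (tens V W y z)"
      if "x \<in> car U" "y \<in> car V" "z \<in> car W" "z' \<in> car W" for x y z z' a
      using True bilinear_tens[of V W] that by (auto simp: bilinear_on_def linear_on_def)
    have ext: "s A = s A'" if "s \<in> car (tensor U V)"
      "\<And>x y. x \<in> car U \<Longrightarrow> y \<in> car V \<Longrightarrow> A x y = A' x y"
      "bilinear_on U V ground A" "bilinear_on U V ground A'" for s A A'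
      using that(1) by (induction rule: tensor_linear_induct)
        (use that(2,3,4) in \<open>auto simp: tens_def fscale_def fun_apply\<close>)
    define G :: "(('d \<Rightarrow> 'e \<Rightarrow> 'a) \<Rightarrow> 'a) \<Rightarrow> 'f \<Rightarrow> 'a"
      where "G = (\<lambda>s z. s (\<lambda>x y. B x (tens V W y z)))"
    have "bilinear_on (tensor U V) W ground G"
      unfolding bilinear_on_def
    proof (intro conjI ballI)
      fix z assume "z \<in> car W"
      then show "linear_on (tensor U V) ground (\<lambda>s. G s z)"
        by (auto simp: G_def linear_on_def fscale_def fun_apply)
    next
      fix s assume s: "s \<in> car (tensor U V)"
      have "G s (z + z') = G s z + G s z'" if z: "z \<in> car W" "z' \<in> car W" "z + z' \<in> car W" for z z'
        unfolding G_def tensor_apply_linear(1)[OF s bz[OF z(1)] bz[OF z(2)], symmetric]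
        by (rule ext[OF s _ bz[OF z(3)]])
          (use z lin2(1) bz[OF z(1)] bz[OF z(2)] in
            \<open>auto simp: bilinear_on_def linear_on_def algebra_simps\<close>)
      moreover have "G s (scl W a z) = a * G s z" if z: "z \<in> car W" "scl W a z \<in> car W" for a z
        unfolding G_def tensor_apply_linear(2)[OF s bz[OF z(1)] bz[OF z(1)], symmetric]
        by (rule ext[OF s _ bz[OF z(2)]])
          (use z lin2(2) bz[OF z(1)] in
            \<open>auto simp: bilinear_on_def linear_on_def algebra_simps\<close>)
      ultimately show "linear_on W ground (G s)"
        using is_vs_closed[OF assms(1)] by (auto simp: linear_on_def)
    qed
    then show ?thesis
      using True bz[OF assms(4)] assms by (simp add: tensor_assoc_def tens_def G_def)
  next
    case False
    then show ?thesis by (simp add: tensor_assoc_def tens_def)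
  qed
qed


lemma K_vs_simps [simp]: "car (K_vs n) = {f. \<forall>i\<ge>n. f i = 0}" "scl (K_vs n) = fscale"
  by (simp_all add: K_vs_def)

lemma K_coalg_simps [simp]: "car (K_coalg n) = {f. \<forall>i\<ge>n. f i = 0}" "scl (K_coalg n) = fscale"
  by (simp_all add: K_coalg_def)

lemma vs_cong:
  assumes "car V = car V'" "scl V = scl V'"
  shows "linear_on V = linear_on V'" "tens V = tens V'" "tensor V = tensor V'"
    "linear_on X V = linear_on X V'" "tens X V = tens X V'" "tensor X V = tensor X V'"
  using assms by (auto simp: fun_eq_iff fun_apply linear_on_def bilinear_on_def tens_def tensor_def)

lemma cvec_in_K: "k < n \<Longrightarrow> cvec k \<in> car (K_coalg n)"
  by (auto simp: cvec_def)

lemma cvec_inj: "inj_on (cvec :: nat \<Rightarrow> nat \<Rightarrow> 'k::field) {..<n}"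
  by (force simp: inj_on_def cvec_def fun_eq_iff split: if_splits)

lemma sum_cvec: "(\<Sum>k<n. fscale (f k) (cvec k)) i = (if i < n then f i else 0)"
proof -
  have "(\<Sum>k\<in>S. fscale (f k) (cvec k)) i = (\<Sum>k\<in>S. if i = k then f k else 0)"
    if "finite S" for S
    using that by induction (auto simp: fscale_def fun_apply cvec_def)
  then show ?thesis by simp
qed

lemma K_span: "car (K_coalg n :: ('a::field, nat \<Rightarrow> 'a) coalg) = fscale.span (cvec ` {..<n})"
proof
  show "fscale.span (cvec ` {..<n} :: (nat \<Rightarrow> 'a) set) \<subseteq> car (K_coalg n)"
    by (rule fscale.span_minimal)
      (auto simp: fscale.subspace_def cvec_def fscale_def fun_apply)
  show "car (K_coalg n) \<subseteq> fscale.span (cvec ` {..<n} :: (nat \<Rightarrow> 'a) set)"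
  proof
    fix f :: "nat \<Rightarrow> 'a" assume "f \<in> car (K_coalg n)"
    then have f: "(\<Sum>k<n. fscale (f k) (cvec k)) = f"
      by (auto simp: fun_eq_iff sum_cvec)
    have "(\<Sum>k<n. fscale (f k) (cvec k)) \<in> fscale.span (cvec ` {..<n})"
      by (intro fscale.span_sum fscale.span_scale fscale.span_base) auto
    then show "f \<in> fscale.span (cvec ` {..<n})" unfolding f .
  qed
qed

lemma K_independent: "fscale.independent (cvec ` {..<n} :: (nat \<Rightarrow> 'a::field) set)"
proof -
  have "u v = 0" if "(\<Sum>v\<in>cvec ` {..<n}. fscale (u v) v) = 0" "v \<in> cvec ` {..<n}"
    for u :: "(nat \<Rightarrow> 'a) \<Rightarrow> 'a" and v
  proof -
    from that(2) obtain i where i: "i < n" "v = cvec i" by blast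
    have "(\<Sum>k<n. fscale (u (cvec k)) (cvec k)) i = 0"
      using that(1) by (simp add: sum.reindex[OF cvec_inj] fun_apply)
    then show ?thesis using i by (simp add: sum_cvec fun_apply)
  qed
  then show ?thesis by (auto simp: fscale.dependent_finite)
qed

lemma K_comult_cvec:
  assumes "k < n"
  shows "comult (K_coalg n) (cvec k)
    = (\<Sum>(i, j) \<in> {(i, j). i + j = k}. tens (K_coalg n) (K_coalg n) (cvec i) (cvec j))"
proof -
  have *: "tens (K_coalg n) (K_coalg n) = tens (K_vs n) (K_vs n)"
    by (simp add: vs_cong(2)[of "K_coalg n" "K_vs n"] vs_cong(5)[of "K_coalg n" "K_vs n"])
  have "comult (K_coalg n) (cvec k) = (\<Sum>l<n. if l = k then
      (\<Sum>(i, j) \<in> {(i, j). i + j = k}. tens (K_vs n) (K_vs n) (cvec i) (cvec j)) else 0)"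
    unfolding K_coalg_def coalg.simps by (rule sum.cong) (auto simp: cvec_def)
  then show ?thesis using assms by (simp add: *)
qed

lemma K_counit_cvec: "k < n \<Longrightarrow> counit (K_coalg n) (cvec k) = (if k = 0 then 1 else 0)"
  by (simp add: K_coalg_def cvec_def if_distrib cong: if_cong)

lemma linear_on_sum:
  assumes "is_vs V" "linear_on V W f" "finite S" "\<And>i. i \<in> S \<Longrightarrow> x i \<in> car V"
  shows "f (\<Sum>i\<in>S. x i) = (\<Sum>i\<in>S. f (x i))"
proof -
  have "f (\<Sum>i\<in>S. x i) = (\<Sum>i\<in>S. f (x i)) \<and> (\<Sum>i\<in>S. x i) \<in> car V"
    using assms(3,4)
  proof induction
    case empty
    then show ?case using linear_on_zero[OF assms(1,2)] is_vs_closed(3)[OF assms(1)] by simp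
  next
    case (insert a S)
    then show ?case
      using is_vs_closed(1)[OF assms(1)] assms(2) by (simp add: linear_on_def)
  qed
  then show ?thesis ..
qed

lemma tensor_map_sum: "tensor_map V W f g (\<Sum>i\<in>S. t i) = (\<Sum>i\<in>S. tensor_map V W f g (t i))"
  by (induction S rule: infinite_finite_induct) auto

lemma tensor_assoc_sum: "tensor_assoc U V W (\<Sum>i\<in>S. t i) = (\<Sum>i\<in>S. tensor_assoc U V W (t i))"
  by (induction S rule: infinite_finite_induct) auto

lemma finite_pairs: "finite {(i, j). i + j = (k::nat)}"
  by (rule finite_subset[of _ "{..k} \<times> {..k}"]) auto

lemma fscale_apply_left:
  "fscale ((f + g) k) t = fscale (f k) t + fscale (g k) t"
  "fscale (fscale a f k) t = fscale a (fscale (f k) t)"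
  by (simp_all add: fscale.scale_left_distrib fun_apply) (simp add: fscale_def mult.assoc)

lemma K_comult_linear':
  "comult (K_coalg n) (f + g) = comult (K_coalg n) f + comult (K_coalg n) g"
  "comult (K_coalg n) (fscale a f) = fscale a (comult (K_coalg n) f)"
  by (simp_all only: K_coalg_def coalg.simps fscale_apply_left sum.distrib fscale.scale_sum_right)

theorem coalgebra_K_coalg: "coalgebra (K_coalg n)"
proof -
  define C :: "('a, nat \<Rightarrow> 'a) coalg" where "C = K_coalg n"
  have vs: "is_vs C"
    by (simp add: C_def is_vs_def fscale.vector_space_axioms)
      (auto simp: fscale.subspace_def fscale_def fun_apply)
  have "comult C (f + g) = comult C f + comult C g"
    "comult C (fscale a f) = fscale a (comult C f)" for f g a
    by (simp_all only: C_def K_comult_linear')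
  note T = tensor_map_linear tensor_assoc_linear this
  have cv: "cvec k \<in> car C" if "k < n" for k using cvec_in_K that unfolding C_def .
  have com: "comult C (cvec k) = (\<Sum>(i, j) \<in> {(i, j). i + j = k}. tens C C (cvec i) (cvec j))"
    if "k < n" for k
    using K_comult_cvec[OF that] by (simp add: C_def)
  have com_in: "comult C (cvec k) \<in> car (tensor C C)" if "k < n" for k
  proof -
    have "(case p of (i, j) \<Rightarrow> tens C C (cvec i) (cvec j)) \<in> car (tensor C C)"
      if "p \<in> {(i, j). i + j = k}" for p
      using that \<open>k < n\<close> by (auto intro!: tens_in_tensor cv)
    then show ?thesis unfolding com[OF that]
      unfolding tensor_def vs.simps by (rule fscale.span_sum)
  qed
  have lin: "linear_on C (tensor C C) (comult C)"
    unfolding linear_on_def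
  proof (intro conjI ballI allI)
    fix f assume "f \<in> car C"
    then have "f \<in> fscale.span (cvec ` {..<n})" by (simp add: C_def K_span[symmetric])
    then show "comult C f \<in> car (tensor C C)"
    proof (induction rule: fscale.span_induct_alt)
      case base
      show ?case using T(8)[of 0 0] is_vs_closed(3)[OF is_vs_tensor, of C C] by (simp only: fscale.scale_zero_left)
    next
      case (step c x y)
      then show ?case
        using com_in is_vs_closed(1,2)[OF is_vs_tensor[of C C]]
        unfolding T scl_tensor by blast
    qed
  qed (use T in \<open>auto simp: C_def\<close>)
  have clin: "linear_on C ground (counit C)"
    by (auto simp: linear_on_def C_def K_coalg_def fscale_def fun_apply algebra_simps sum.distrib
        sum_distrib_left)
  have idl: "linear_on V V id" for V :: "('x::field, 'y::ab_group_add, 'z) vs_scheme"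
    by (simp add: linear_on_def)
  have coassoc: "tensor_assoc C C C (tensor_map (tensor C C) C (comult C) id (comult C (cvec k)))
        = tensor_map C (tensor C C) id (comult C) (comult C (cvec k))" if k: "k < n" for k
  proof -
    let ?P = "\<lambda>k. {(i, j). i + j = (k::nat)}"
    have L: "tens (tensor C C) C (comult C (cvec i)) (cvec j)
       = (\<Sum>(a, b) \<in> ?P i. tens (tensor C C) C (tens C C (cvec a) (cvec b)) (cvec j))"
      if "i < n" "j < n" for i j
    proof -
      have "linear_on (tensor C C) (tensor (tensor C C) C) (\<lambda>x. tens (tensor C C) C x (cvec j))"
        using bilinear_tens[of "tensor C C" C] cv[OF that(2)] by (simp add: bilinear_on_def)
      moreover have "(case p of (a, b) \<Rightarrow> tens C C (cvec a) (cvec b)) \<in> car (tensor C C)"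
        if "p \<in> ?P i" for p
        using that \<open>i < n\<close> by (auto intro!: tens_in_tensor cv)
      ultimately show ?thesis
        unfolding com[OF \<open>i < n\<close>]
        by (subst linear_on_sum[OF is_vs_tensor _ finite_pairs]) (auto simp: case_prod_unfold)
    qed
    have R: "tens C (tensor C C) (cvec i) (comult C (cvec j))
       = (\<Sum>(a, b) \<in> ?P j. tens C (tensor C C) (cvec i) (tens C C (cvec a) (cvec b)))"
      if "i < n" "j < n" for i j
    proof -
      have "linear_on (tensor C C) (tensor C (tensor C C)) (tens C (tensor C C) (cvec i))"
        using bilinear_tens[of C "tensor C C"] cv[OF that(1)] by (simp add: bilinear_on_def)
      moreover have "(case p of (a, b) \<Rightarrow> tens C C (cvec a) (cvec b)) \<in> car (tensor C C)"
        if "p \<in> ?P j" for p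
        using that \<open>j < n\<close> by (auto intro!: tens_in_tensor cv)
      ultimately show ?thesis
        unfolding com[OF \<open>j < n\<close>]
        by (subst linear_on_sum[OF is_vs_tensor _ finite_pairs]) (auto simp: case_prod_unfold)
    qed
    have "tensor_assoc C C C (tensor_map (tensor C C) C (comult C) id (comult C (cvec k)))
      = (\<Sum>(i, j) \<in> ?P k. \<Sum>(a, b) \<in> ?P i.
          tens C (tensor C C) (cvec a) (tens C C (cvec b) (cvec j)))"
      unfolding com[OF k] tensor_map_sum tensor_assoc_sum
    proof (rule sum.cong[OF refl], clarify)
      fix i j assume ij: "k = i + j"
      have "tensor_assoc C C C (tensor_map (tensor C C) C (comult C) id (tens C C (cvec i) (cvec j)))
        = (\<Sum>p \<in> ?P i. tensor_assoc C C C
            (case p of (a, b) \<Rightarrow> tens (tensor C C) C (tens C C (cvec a) (cvec b)) (cvec j)))"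
        using ij k by (simp add: tensor_map_tens[OF lin idl] L tensor_assoc_sum)
      also have "\<dots> = (\<Sum>(a, b) \<in> ?P i. tens C (tensor C C) (cvec a) (tens C C (cvec b) (cvec j)))"
        by (rule sum.cong[OF refl]) (use ij k vs in \<open>auto intro!: tensor_assoc_tens cv\<close>)
      finally show "tensor_assoc C C C (tensor_map (tensor C C) C (comult C) id
          (tens C C (cvec i) (cvec j)))
        = (\<Sum>(a, b) \<in> ?P i. tens C (tensor C C) (cvec a) (tens C C (cvec b) (cvec j)))" .
    qed
    also have "\<dots> = (\<Sum>((i, j), (a, b)) \<in> Sigma (?P k) (\<lambda>(i, j). ?P i).
          tens C (tensor C C) (cvec a) (tens C C (cvec b) (cvec j)))"
      using finite_pairs by (subst sum.Sigma[symmetric]) (auto simp: case_prod_unfold)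
    also have "\<dots> = (\<Sum>((i, j), (a, b)) \<in> Sigma (?P k) (\<lambda>(i, j). ?P j).
          tens C (tensor C C) (cvec i) (tens C C (cvec a) (cvec b)))"
      by (rule sum.reindex_bij_witness[of _ "\<lambda>((i, j), (a, b)). ((i + a, b), (i, a))"
            "\<lambda>((i, j), (a, b)). ((a, b + j), (b, j))"]) auto
    also have "\<dots> = (\<Sum>(i, j) \<in> ?P k. \<Sum>(a, b) \<in> ?P j.
          tens C (tensor C C) (cvec i) (tens C C (cvec a) (cvec b)))"
      using finite_pairs by (subst sum.Sigma[symmetric]) (auto simp: case_prod_unfold)
    also have "\<dots> = tensor_map C (tensor C C) id (comult C) (comult C (cvec k))"
      unfolding com[OF k] tensor_map_sum
      by (rule sum.cong[OF refl]) (use k in \<open>auto simp: tensor_map_tens[OF idl lin] R\<close>)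
    finally show ?thesis .
  qed
  have zero_left: "tens ground C 0 c = 0" if "c \<in> car C" for c
    using that bilinear_tens[of ground C] linear_on_zero[OF is_vs_ground]
    unfolding bilinear_on_def by blast
  have zero_right: "tens C ground c 0 = 0" if "c \<in> car C" for c
    using that bilinear_tens[of C ground] linear_on_zero[OF is_vs_ground]
    unfolding bilinear_on_def by blast
  have ce: "counit C (cvec k) = (if k = 0 then 1 else 0)" if "k < n" for k
    using K_counit_cvec[OF that] by (simp add: C_def)
  have left: "tensor_map ground C (counit C) id (comult C (cvec k)) = tens ground C 1 (cvec k)"
    if k: "k < n" for k
  proof -
    have "tensor_map ground C (counit C) id (comult C (cvec k))
      = (\<Sum>p \<in> {(i, j). i + j = k}. if p = (0, k) then tens ground C 1 (cvec k) else 0)"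
      unfolding com[OF k] tensor_map_sum
      by (rule sum.cong[OF refl])
        (use k in \<open>auto simp: tensor_map_tens[OF clin idl] ce zero_left[OF cv] split: if_splits\<close>)
    then show ?thesis using finite_pairs by simp
  qed
  have right: "tensor_map C ground id (counit C) (comult C (cvec k)) = tens C ground (cvec k) 1"
    if k: "k < n" for k
  proof -
    have "tensor_map C ground id (counit C) (comult C (cvec k))
      = (\<Sum>p \<in> {(i, j). i + j = k}. if p = (k, 0) then tens C ground (cvec k) 1 else 0)"
      unfolding com[OF k] tensor_map_sum
      by (rule sum.cong[OF refl])
        (use k in \<open>auto simp: tensor_map_tens[OF idl clin] ce zero_right[OF cv] split: if_splits\<close>)
    then show ?thesis using finite_pairs by simp
  qed
  have ext: "F f = G f" if "f \<in> car C" "linear_on C \<lparr>car = UNIV, scl = fscale\<rparr> F"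
    "linear_on C \<lparr>car = UNIV, scl = fscale\<rparr> G" "\<And>k. k < n \<Longrightarrow> F (cvec k) = G (cvec k)"
    for f and F G :: "(nat \<Rightarrow> 'a) \<Rightarrow> 'x \<Rightarrow> 'a"
  proof -
    have sc: "scl C = fscale" by (simp add: C_def)
    have "f \<in> fscale.span (cvec ` {..<n})" using that by (simp add: C_def K_span[symmetric])
    then have "f \<in> car C \<and> F f = G f"
    proof (induction rule: fscale.span_induct_alt)
      case base
      show ?case using linear_on_zero[OF vs] that is_vs_closed(3)[OF vs] by metis
    next
      case (step c x y)
      then have x: "x \<in> car C" "F x = G x" using cv that(4) by auto
      have "fscale c x \<in> car C" using is_vs_closed(2)[OF vs x(1)] by (simp add: sc)
      then show ?case
        using x step that(2,3) is_vs_closed(1)[OF vs] by (simp add: linear_on_def sc)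
    qed
    then show ?thesis ..
  qed
  show ?thesis
    unfolding C_def[symmetric]
  proof
    show "is_vs C" "linear_on C (tensor C C) (comult C)" "linear_on C ground (counit C)" by fact+
    fix c assume c: "c \<in> car C"
    have sc: "scl C = fscale" by (simp add: C_def)
    show "tensor_assoc C C C (tensor_map (tensor C C) C (comult C) id (comult C c))
        = tensor_map C (tensor C C) id (comult C) (comult C c)"
      using c by (rule ext) (simp_all add: T linear_on_def sc coassoc del: id_apply)
    show "tensor_map ground C (counit C) id (comult C c) = tens ground C 1 c"
      using c by (rule ext) (use left bilinear_tens[of ground C] in
        \<open>auto simp: T linear_on_def bilinear_on_def sc simp del: id_apply\<close>)
    show "tensor_map C ground id (counit C) (comult C c) = tens C ground c 1"
      using c by (rule ext) (use right bilinear_tens[of C ground] in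
        \<open>auto simp: T linear_on_def bilinear_on_def sc simp del: id_apply\<close>)
  qed
qed

end

theory Submission
  imports Defs
begin

text \<open>
  The proof passes to the dual space \<open>A = C*\<close> with the convolution product
  \<open>(p \<star> q)(c) = (p \<otimes> q)(\<Delta> c)\<close>, a finite dimensional algebra with unit \<open>\<epsilon>\<close>.
  For \<open>a \<in> A\<close> the common zero set of the left ideal \<open>A a\<close> is a left subcomodule of \<open>C\<close>
  (\<open>annihilator_left_subcomodule\<close>), and \<open>A a\<close> can be recovered from it because a subspace of a
  finite dimensional dual is its own double annihilator (\<open>double_annihilator\<close>). So the chain
  condition on \<open>C\<close> makes any two principal left ideals of \<open>A\<close> comparable (\<open>dual_left_chain\<close>).

  Such an algebra over an algebraically closed field is a truncated polynomial algebra
  (\<open>left_chain_truncated_polynomial\<close>). By comparability, the elements that are not left invertible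
  form a left ideal \<open>R\<close>, and \<open>R = A x\<close> for a single \<open>x\<close>. Every element \<open>s\<close> of \<open>A\<close> has an
  eigenvalue \<open>l\<close>, for which \<open>s - l\<close> lies in \<open>R\<close>; hence \<open>A = K + A x\<close>, and by iteration
  \<open>A = K + K x + \<dots> + K x^(j-1) + A x^j\<close> for all \<open>j\<close>. Moreover \<open>x\<close> is nilpotent, since it
  satisfies a polynomial equation and a polynomial in \<open>x\<close> with nonzero constant term is left
  invertible. If \<open>m\<close> is least with \<open>x^m = 0\<close>, then \<open>1, x, \<dots>, x^(m-1)\<close> is a basis of \<open>A\<close>.

  The functionals \<open>p_i = x^i\<close>, \<open>i < m\<close>, therefore form a coordinate system on \<open>C\<close>, that is,
  \<open>c \<mapsto> (p_i(c))_i\<close> is a linear bijection onto \<open>K^m\<close> (\<open>dual_coordinates_bij\<close>). The rules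
  \<open>p_i \<star> p_j = p_(i+j)\<close> and \<open>p_0 = \<epsilon>\<close> say exactly that it respects comultiplication and counit,
  when the target is \<open>K_coalg m\<close>.
\<close>

section \<open>Finite dimensional algebras whose principal left ideals form a chain\<close>

text \<open>
  The dependence is stated for a sequence and not for its range: a repeated entry also counts
  as a linear relation. This is what yields a polynomial relation between the powers of an element.
\<close>

lemma (in vector_space) sequence_dependent:
  assumes "finite G" and "\<And>i. u i \<in> span G"
  shows "\<exists>f n. (\<exists>i<n. f i \<noteq> 0) \<and> (\<Sum>i<n. scale (f i) (u (i::nat))) = 0"
proof (cases "inj_on u {..<Suc (card G)}")
  case False
  then obtain i j where ij: "i \<noteq> j" "u i = u j" by (auto simp: inj_on_def)
  let ?f = "\<lambda>k. (if k = i then 1 else 0) - (if k = j then 1 else 0)"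
  have "(\<Sum>k<Suc (max i j). scale (?f k) (u k))
      = (\<Sum>k<Suc (max i j). (if k = i then u k else 0) - (if k = j then u k else 0))"
    by (rule sum.cong) auto
  also have "\<dots> = u i - u j" by (simp add: sum_subtractf less_Suc_eq_le del: sum.lessThan_Suc)
  also have "\<dots> = 0" using ij(2) by simp
  finally show ?thesis using ij by (intro exI[of _ ?f] exI[of _ "Suc (max i j)"]) auto
next
  case inj: True
  have "dependent (u ` {..<Suc (card G)})"
    using independent_span_bound[OF assms(1), of "u ` {..<Suc (card G)}"] assms(2) card_image[OF inj]
    by auto
  then obtain w v where "v \<in> u ` {..<Suc (card G)}" "w v \<noteq> 0"
    "(\<Sum>v\<in>u ` {..<Suc (card G)}. scale (w v) v) = 0"
    by (auto simp: dependent_finite)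
  then show ?thesis
    by (intro exI[of _ "\<lambda>i. w (u i)"] exI[of _ "Suc (card G)"])
      (auto simp: sum.reindex[OF inj] simp del: sum.lessThan_Suc)
qed

text \<open>
  A unital associative algebra on a subspace of an ambient vector space. The product is constrained
  only on the carrier, since in the application it is a convolution product whose laws hold for
  linear functionals and not for arbitrary functions.
\<close>

locale fin_dim_algebra = vector_space scale
  for scale :: "'k::alg_closed_field \<Rightarrow> 'a::ab_group_add \<Rightarrow> 'a" (infixr "*s" 75) +
  fixes A :: "'a set" and mul :: "'a \<Rightarrow> 'a \<Rightarrow> 'a" (infixl "\<star>" 70) and one :: 'a ("\<one>")
  assumes subspace: "subspace A"
    and fin_dim: "\<exists>G. finite G \<and> A \<subseteq> span G"
    and mul_closed: "a \<in> A \<Longrightarrow> b \<in> A \<Longrightarrow> a \<star> b \<in> A"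
    and one_closed: "\<one> \<in> A"
    and mul_assoc: "a \<in> A \<Longrightarrow> b \<in> A \<Longrightarrow> c \<in> A \<Longrightarrow> a \<star> b \<star> c = a \<star> (b \<star> c)"
    and one_mul: "a \<in> A \<Longrightarrow> \<one> \<star> a = a"
    and mul_one: "a \<in> A \<Longrightarrow> a \<star> \<one> = a"
    and add_mul: "a \<in> A \<Longrightarrow> b \<in> A \<Longrightarrow> c \<in> A \<Longrightarrow> (a + b) \<star> c = a \<star> c + b \<star> c"
    and mul_add: "a \<in> A \<Longrightarrow> b \<in> A \<Longrightarrow> c \<in> A \<Longrightarrow> a \<star> (b + c) = a \<star> b + a \<star> c"
    and scale_mul: "a \<in> A \<Longrightarrow> b \<in> A \<Longrightarrow> (t *s a) \<star> b = t *s (a \<star> b)"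
    and mul_scale: "a \<in> A \<Longrightarrow> b \<in> A \<Longrightarrow> a \<star> (t *s b) = t *s (a \<star> b)"
begin

lemma closed [simp]:
  "0 \<in> A" "\<one> \<in> A" "a \<in> A \<Longrightarrow> b \<in> A \<Longrightarrow> a + b \<in> A" "a \<in> A \<Longrightarrow> b \<in> A \<Longrightarrow> a - b \<in> A"
  "a \<in> A \<Longrightarrow> t *s a \<in> A" "a \<in> A \<Longrightarrow> b \<in> A \<Longrightarrow> a \<star> b \<in> A"
  using subspace_0 subspace_add subspace_scale subspace_diff subspace mul_closed
    one_closed by auto

lemma mul_zero [simp]: "a \<in> A \<Longrightarrow> a \<star> 0 = 0"
  using mul_scale[of a 0 0] by simp

lemma zero_mul [simp]: "a \<in> A \<Longrightarrow> 0 \<star> a = 0"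
  using scale_mul[of 0 a 0] by simp

lemma diff_mul: "a \<in> A \<Longrightarrow> b \<in> A \<Longrightarrow> c \<in> A \<Longrightarrow> (a - b) \<star> c = a \<star> c - b \<star> c"
  using add_mul[of "a - b" b c] by (simp add: algebra_simps)

lemma sum_closed: "(\<And>i. i \<in> S \<Longrightarrow> u i \<in> A) \<Longrightarrow> (\<Sum>i\<in>S. u i) \<in> A"
  by (rule subspace_sum[OF subspace])

lemma mul_sum:
  assumes "a \<in> A" "\<And>i. i \<in> S \<Longrightarrow> u i \<in> A"
  shows "a \<star> (\<Sum>i\<in>S. u i) = (\<Sum>i\<in>S. a \<star> u i)"
  using assms(2)
  by (induction S rule: infinite_finite_induct) (auto simp: assms(1) mul_add sum_closed)

primrec pow :: "'a \<Rightarrow> nat \<Rightarrow> 'a" where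
  "pow s 0 = \<one>"
| "pow s (Suc n) = s \<star> pow s n"

lemma pow_closed [simp]: "s \<in> A \<Longrightarrow> pow s n \<in> A"
  by (induction n) auto

lemma pow_add: "s \<in> A \<Longrightarrow> pow s (i + j) = pow s i \<star> pow s j"
  by (induction i) (auto simp: one_mul mul_assoc)

lemma pow_ge_zero: "s \<in> A \<Longrightarrow> pow s m = 0 \<Longrightarrow> m \<le> k \<Longrightarrow> pow s k = 0"
  using pow_add[of s m "k - m"] by simp

definition ev :: "'a \<Rightarrow> 'k poly \<Rightarrow> 'a" where
  "ev s P = (\<Sum>i\<le>degree P. coeff P i *s pow s i)"

lemma ev_eq:
  assumes "degree P \<le> n"
  shows "ev s P = (\<Sum>i\<le>n. coeff P i *s pow s i)"
  unfolding ev_def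
  by (rule sum.mono_neutral_left) (use assms in \<open>auto simp: coeff_eq_0\<close>)

lemma ev_closed [simp]: "s \<in> A \<Longrightarrow> ev s P \<in> A"
  by (auto simp: ev_def intro!: sum_closed)

lemma ev_0 [simp]: "ev s 0 = 0"
  by (simp add: ev_def)

lemma ev_pCons:
  assumes "s \<in> A"
  shows "ev s (pCons a P) = a *s \<one> + s \<star> ev s P"
proof -
  have "ev s (pCons a P) = (\<Sum>i\<le>Suc (degree P). coeff (pCons a P) i *s pow s i)"
    by (rule ev_eq) (simp add: degree_pCons_le)
  also have "\<dots> = a *s \<one> + s \<star> ev s P"
    using assms unfolding ev_def by (subst sum.atMost_Suc_shift) (simp add: mul_sum mul_scale)
  finally show ?thesis .
qed

lemma ev_diff: "ev s (P - Q) = ev s P - ev s Q"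
  using ev_eq[of P "max (degree P) (degree Q)" s] ev_eq[of Q "max (degree P) (degree Q)" s]
    ev_eq[of "P - Q" "max (degree P) (degree Q)" s]
  by (simp add: degree_diff_le scale_left_diff_distrib sum_subtractf)

lemma ev_smult: "ev s (smult t P) = t *s ev s P"
  using ev_eq[of "smult t P" "degree P" s] by (simp add: ev_def scale_sum_right)

text \<open>
  Evaluation at \<open>s\<close> is multiplicative. Here the first factor is the one that a root \<open>l\<close>
  of a polynomial splits off.
\<close>

lemma ev_linear_factor:
  assumes "s \<in> A"
  shows "ev s ([:-l, 1:] * Q) = (s - l *s \<one>) \<star> ev s Q"
proof -
  have "[:-l, 1:] * Q = pCons 0 Q - smult l Q" by simp
  then show ?thesis
    using assms by (simp add: ev_diff ev_smult ev_pCons diff_mul scale_mul one_mul)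
qed

lemma ev_commute: "s \<in> A \<Longrightarrow> ev s P \<star> s = s \<star> ev s P"
  by (induction P) (simp_all add: ev_pCons add_mul mul_add scale_mul mul_scale one_mul mul_one mul_assoc)

lemma annihilating_poly:
  assumes s: "s \<in> A"
  obtains P where "P \<noteq> 0" "ev s P = 0"
proof -
  obtain G where "finite G" "A \<subseteq> span G" using fin_dim by blast
  then obtain f n i where f: "i < n" "f i \<noteq> 0" "(\<Sum>i<n. f i *s pow s i) = 0"
    using sequence_dependent[of G "pow s"] s pow_closed by blast
  define P where "P = (\<Sum>i<n. monom (f i) i)"
  have co: "coeff P j = (if j < n then f j else 0)" for j
    by (simp add: P_def coeff_sum)
  then have "degree P \<le> n" by (intro degree_le) auto
  then have "ev s P = (\<Sum>i\<le>n. coeff P i *s pow s i)" by (rule ev_eq)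
  also have "\<dots> = (\<Sum>i<n. f i *s pow s i)"
    by (simp add: co lessThan_Suc_atMost[symmetric])
  finally have "ev s P = 0" using f(3) by simp
  moreover have "P \<noteq> 0" using co[of i] f by auto
  ultimately show thesis using that by blast
qed

definition left_invertible :: "'a \<Rightarrow> bool" where
  "left_invertible a \<longleftrightarrow> (\<exists>r\<in>A. r \<star> a = \<one>)"

lemma left_invertible_cancel:
  assumes "left_invertible a" "a \<in> A" "b \<in> A" "a \<star> b = 0"
  shows "b = 0"
proof -
  obtain r where r: "r \<in> A" "r \<star> a = \<one>" using assms(1) by (auto simp: left_invertible_def)
  have "b = r \<star> (a \<star> b)" using r assms(2,3) by (metis mul_assoc one_mul)
  then show ?thesis using assms(4) r by simp
qed

text \<open>
  In a factorisation of an annihilating polynomial of \<open>s\<close> into linear factors, not all the factors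
  \<open>s - l\<close> can be left invertible: otherwise they could be cancelled one after the other until a
  nonzero constant is left.
\<close>

lemma eigenvalue:
  assumes s: "s \<in> A" and "\<one> \<noteq> 0"
  shows "\<exists>l. \<not> left_invertible (s - l *s \<one>)"
proof -
  obtain P where "P \<noteq> 0" "ev s P = 0" using annihilating_poly[OF s] .
  then show ?thesis
  proof (induction "degree P" arbitrary: P)
    case 0
    then obtain c where "P = [:c:]" "c \<noteq> 0" by (metis degree_0_id pCons_0_0)
    then show ?case using 0 s \<open>\<one> \<noteq> 0\<close> by (simp add: ev_pCons)
  next
    case (Suc d)
    then obtain l where "poly P l = 0" using alg_closed_imp_poly_has_root[of P] by auto
    then obtain Q where Q: "P = [:-l, 1:] * Q" by (auto simp: poly_eq_0_iff_dvd dvd_def)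
    then have Q0: "Q \<noteq> 0" using Suc by auto
    then have "d = degree Q" using Suc(2) unfolding Q by (subst (asm) degree_mult_eq) auto
    show ?case
    proof (cases "left_invertible (s - l *s \<one>)")
      case True
      then have "ev s Q = 0"
        using Suc(4) s unfolding Q ev_linear_factor[OF s]
        by (auto intro: left_invertible_cancel)
      then show ?thesis using Suc(1) \<open>d = degree Q\<close> Q0 by blast
    qed blast
  qed
qed

end

text \<open>
  The chain condition says that the left ideals \<open>A a\<close> and \<open>A b\<close> are comparable, in the form of a
  divisibility: one of the generators is a left multiple of the other. The zero algebra is excluded,
  because there \<open>0\<close> is left invertible and \<open>rad\<close> below would be empty.
\<close>

locale left_chain_algebra = fin_dim_algebra scale A mul one
  for scale :: "'k::alg_closed_field \<Rightarrow> 'a::ab_group_add \<Rightarrow> 'a" (infixr "*s" 75)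
    and A and mul (infixl "\<star>" 70) and one ("\<one>") +
  assumes chain: "a \<in> A \<Longrightarrow> b \<in> A \<Longrightarrow> (\<exists>r\<in>A. b = r \<star> a) \<or> (\<exists>r\<in>A. a = r \<star> b)"
    and nontrivial: "\<one> \<noteq> 0"
begin

definition rad :: "'a set" where
  "rad = {a \<in> A. \<not> left_invertible a}"

lemma rad_mul:
  assumes "r \<in> A" "a \<in> rad"
  shows "r \<star> a \<in> rad"
  using assms unfolding rad_def left_invertible_def by (auto simp flip: mul_assoc)

text \<open>
  If \<open>b = r a\<close>, then \<open>a + b = (1 + r) a\<close>. This is a left multiple of an element of \<open>rad\<close>;
  by comparability, one of the two summands is a left multiple of the other.
\<close>

lemma rad_add:
  assumes "a \<in> rad" "b \<in> rad"
  shows "a + b \<in> rad"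
proof -
  have *: "a + r \<star> a \<in> rad" if "a \<in> rad" "r \<in> A" for a r
  proof -
    have "a + r \<star> a = (\<one> + r) \<star> a" using that by (simp add: add_mul one_mul rad_def)
    then show ?thesis using that by (simp add: rad_mul)
  qed
  from assms have "a \<in> A" "b \<in> A" by (auto simp: rad_def)
  from chain[OF this] show ?thesis using *[of a] *[of b] assms by (auto simp: add.commute)
qed

lemma subspace_rad: "subspace rad"
proof (rule subspaceI)
  show "0 \<in> rad" using nontrivial by (auto simp: rad_def left_invertible_def)
  show "t *s a \<in> rad" if "a \<in> rad" for t a
  proof -
    have "t *s a = (t *s \<one>) \<star> a" using that by (simp add: scale_mul one_mul rad_def)
    then show ?thesis using that by (simp add: rad_mul)
  qed
qed (rule rad_add)

lemma unit_plus_rad: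
  assumes "c \<noteq> 0" "a \<in> rad"
  shows "left_invertible (c *s \<one> + a)"
proof (rule ccontr)
  assume "\<not> ?thesis"
  then have "c *s \<one> + a \<in> rad" using assms by (simp add: rad_def)
  then have "inverse c *s ((c *s \<one> + a) - a) \<in> rad"
    using assms(2) subspace_rad by (intro subspace_scale subspace_diff)
  then have "\<one> \<in> rad" using assms(1) by simp
  then show False using one_mul[OF one_closed] one_closed by (auto simp: rad_def left_invertible_def)
qed

lemma finite_subset_principal:
  assumes "finite F" "F \<subseteq> rad"
  shows "\<exists>x\<in>rad. \<forall>a\<in>F. \<exists>r\<in>A. a = r \<star> x"
  using assms
proof (induction rule: finite_induct)
  case empty
  then show ?case using subspace_0[OF subspace_rad] by auto
next
  case (insert b F)
  then obtain x where x: "x \<in> rad" "\<forall>a\<in>F. \<exists>r\<in>A. a = r \<star> x" by auto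
  then have xA: "x \<in> A" "b \<in> A" using insert by (auto simp: rad_def)
  from chain[OF this] show ?case
  proof
    assume "\<exists>r\<in>A. b = r \<star> x"
    then show ?thesis using x by auto
  next
    assume "\<exists>r\<in>A. x = r \<star> b"
    then obtain r where r: "r \<in> A" "x = r \<star> b" by blast
    have "\<exists>r\<in>A. a = r \<star> b" if "a \<in> F" for a
      using x(2) that r mul_closed mul_assoc xA by metis
    moreover have "b = \<one> \<star> b" using xA by (simp add: one_mul)
    ultimately show ?thesis using insert.prems one_closed by (intro bexI[of _ b]) auto
  qed
qed

text \<open>
  Finitely many elements span \<open>rad\<close>, and one of them is a right divisor of the others by
  comparability.
\<close>

lemma rad_principal:
  obtains x where "x \<in> rad" "\<And>a. a \<in> rad \<Longrightarrow> \<exists>r\<in>A. a = r \<star> x"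
proof -
  obtain F where F: "F \<subseteq> rad" "independent F" "rad \<subseteq> span F"
    by (rule maximal_independent_subset)
  obtain G where G: "finite G" "A \<subseteq> span G" using fin_dim by blast
  have "finite F"
    using independent_span_bound[OF G(1) F(2)] F(1) G(2) by (auto simp: rad_def)
  then obtain x where x: "x \<in> rad" "\<forall>a\<in>F. \<exists>r\<in>A. a = r \<star> x"
    using finite_subset_principal F(1) by blast
  have xA: "x \<in> A" using x by (simp add: rad_def)
  have "subspace {a. \<exists>r\<in>A. a = r \<star> x}"
  proof (rule subspaceI)
    show "0 \<in> {a. \<exists>r\<in>A. a = r \<star> x}" using xA by (auto intro!: bexI[of _ 0])
  qed (use xA in \<open>auto simp flip: add_mul scale_mul\<close>)
  then have "span F \<subseteq> {a. \<exists>r\<in>A. a = r \<star> x}"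
    using x(2) by (intro span_minimal) auto
  then show thesis using that x(1) F(3) by blast
qed

text \<open>
  Take a polynomial relation \<open>P(x) = 0\<close> and move the factors \<open>x\<close> of \<open>P(x)\<close> out to the right. What remains
  has nonzero constant term, so it is left invertible and can be cancelled, which leaves a power
  of \<open>x\<close> that vanishes. The induction carries the power \<open>pow x j\<close> that has been moved out so far.
\<close>

lemma rad_nilpotent:
  assumes x: "x \<in> rad"
  shows "\<exists>m. pow x m = 0"
proof -
  have xA: "x \<in> A" using x by (simp add: rad_def)
  obtain P where "P \<noteq> 0" "ev x P = 0" using annihilating_poly[OF xA] .
  then have "P \<noteq> 0" "ev x P \<star> pow x 0 = 0" using xA by (simp_all add: mul_one)
  moreover have "\<exists>m. pow x m = 0" if "P \<noteq> 0" "ev x P \<star> pow x j = 0" for P j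
    using that
  proof (induction P arbitrary: j)
    case 0
    then show ?case by simp
  next
    case (pCons c Q)
    show ?case
    proof (cases "c = 0")
      case True
      then have "ev x Q \<star> pow x (Suc j) = 0"
        using pCons.prems xA by (simp add: ev_pCons ev_commute[symmetric] mul_assoc)
      then show ?thesis using pCons.IH pCons.hyps True by blast
    next
      case False
      have "x \<star> ev x Q \<in> rad" using rad_mul[OF _ x] xA by (simp add: ev_commute[symmetric])
      from unit_plus_rad[OF False this] have "left_invertible (ev x (pCons c Q))"
        using xA by (simp add: ev_pCons)
      then show ?thesis using left_invertible_cancel pCons.prems xA by (metis ev_closed pow_closed)
    qed
  qed
  ultimately show ?thesis by blast
qed

end

text \<open>
  The algebra is \<open>K[x]/(x^m)\<close>, where \<open>x\<close> generates \<open>rad\<close> and \<open>m\<close> is its order of nilpotency.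
  The zero algebra is the case \<open>m = 0\<close>.
\<close>

theorem (in fin_dim_algebra) left_chain_truncated_polynomial:
  assumes chain: "\<And>a b. a \<in> A \<Longrightarrow> b \<in> A \<Longrightarrow> (\<exists>r\<in>A. b = r \<star> a) \<or> (\<exists>r\<in>A. a = r \<star> b)"
  obtains x m where "x \<in> A" "pow x m = 0"
    "\<And>f. (\<Sum>i<m. f i *s pow x i) = 0 \<Longrightarrow> \<forall>i<m. f i = 0"
    "\<And>a. a \<in> A \<Longrightarrow> \<exists>f. a = (\<Sum>i<m. f i *s pow x i)"
proof (cases "\<one> = 0")
  case True
  have "a = 0" if "a \<in> A" for a using one_mul[OF that] zero_mul[OF that] True by simp
  moreover have "pow 0 0 = 0" by (subst pow.simps(1)) (rule True)
  ultimately show thesis using that[of 0 0] by simp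
next
  case False
  interpret left_chain_algebra scale A mul one
    by unfold_locales (use chain False in auto)
  obtain x where x: "x \<in> rad" and gen: "\<And>a. a \<in> rad \<Longrightarrow> \<exists>r\<in>A. a = r \<star> x"
    using rad_principal by blast
  have xA: "x \<in> A" using x by (simp add: rad_def)
  define m where "m = (LEAST m. pow x m = 0)"
  have m: "pow x m = 0" unfolding m_def using rad_nilpotent[OF x] by (rule LeastI_ex)
  have less: "pow x j \<noteq> 0" if "j < m" for j using that unfolding m_def by (rule not_less_Least)
  have "f i = 0" if f: "(\<Sum>i<m. f i *s pow x i) = 0" and "i < m" for f i
    using \<open>i < m\<close>
  proof (induction i rule: less_induct)
    case (less i)
    \<comment> \<open>Multiplication by \<open>x^(m-1-i)\<close> kills the terms above \<open>i\<close>; those below vanish by induction.\<close>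
    have "pow x (m - Suc i) \<star> (\<Sum>k<m. f k *s pow x k)
        = (\<Sum>k<m. f k *s pow x (m - Suc i + k))"
      using xA by (simp add: mul_sum mul_scale pow_add)
    also have "\<dots> = (\<Sum>k<m. if k = i then f i *s pow x (m - 1) else 0)"
    proof (rule sum.cong[OF refl])
      fix k assume k: "k \<in> {..<m}"
      consider "k < i" | "k = i" | "k > i" by linarith
      then show "f k *s pow x (m - Suc i + k) = (if k = i then f i *s pow x (m - 1) else 0)"
        using less k pow_ge_zero[OF xA m, of "m - Suc i + k"] by cases auto
    qed
    also have "\<dots> = f i *s pow x (m - 1)" using less by simp
    finally have "f i *s pow x (m - 1) = 0" using f xA by simp
    then show ?case using \<open>\<And>j. j < m \<Longrightarrow> pow x j \<noteq> 0\<close>[of "m - 1"] less.prems by simp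
  qed
  moreover have "\<exists>f. a = (\<Sum>i<m. f i *s pow x i)" if "a \<in> A" for a
  proof -
    have "\<exists>f. \<exists>r\<in>A. a = (\<Sum>i<j. f i *s pow x i) + r \<star> pow x j" for j
    proof (induction j)
      case 0
      show ?case using that by (auto intro!: bexI[of _ a] simp: mul_one)
    next
      case (Suc j)
      then obtain f r where r: "r \<in> A" "a = (\<Sum>i<j. f i *s pow x i) + r \<star> pow x j" by blast
      \<comment> \<open>Replace the remainder \<open>r\<close> by a scalar plus a left multiple of \<open>x\<close>.\<close>
      obtain l where "\<not> left_invertible (r - l *s \<one>)" using eigenvalue[OF r(1) False] by blast
      then have "r - l *s \<one> \<in> rad" using r by (simp add: rad_def)
      then obtain q where q: "q \<in> A" "r - l *s \<one> = q \<star> x" using gen by blast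
      then have "r = l *s \<one> + q \<star> x" by (metis add.commute diff_add_cancel)
      then have "r \<star> pow x j = l *s pow x j + q \<star> pow x (Suc j)"
        using q xA by (simp add: add_mul scale_mul one_mul mul_assoc)
      then have "a = (\<Sum>i<Suc j. (f(j := l)) i *s pow x i) + q \<star> pow x (Suc j)"
        using r(2) by simp
      then show ?case using q(1) by blast
    qed
    from this[of m] show ?thesis using m by auto
  qed
  ultimately show thesis using that[OF xA m] by blast
qed

section \<open>Dual spaces and annihilators\<close>

text \<open>
  Functionals vanish outside the carrier, so that they are equal as functions as soon as they
  agree on the carrier.
\<close>

definition dual_space :: "('k::field, 'v::ab_group_add, 'm) vs_scheme \<Rightarrow> ('v \<Rightarrow> 'k) set" where
  "dual_space V = {p. linear_on V ground p \<and> (\<forall>x. x \<notin> car V \<longrightarrow> p x = 0)}"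

lemma dual_linear: "p \<in> dual_space V \<Longrightarrow> linear_on V ground p"
  by (simp add: dual_space_def)

lemma dual_eqI:
  "p \<in> dual_space V \<Longrightarrow> q \<in> dual_space V \<Longrightarrow> (\<And>x. x \<in> car V \<Longrightarrow> p x = q x) \<Longrightarrow> p = q"
  unfolding dual_space_def by (auto intro!: ext) metis

lemma subspace_dual: "fscale.subspace (dual_space V)"
  by (rule fscale.subspaceI)
    (auto simp: dual_space_def linear_on_def fun_apply fscale_def algebra_simps)

text \<open>
  The functional \<open>\<beta> b\<close> is the coordinate at \<open>b\<close> with respect to a basis \<open>B\<close> of \<open>V\<close>.
\<close>

lemma dual_basis:
  fixes V :: "('k::field, 'v::ab_group_add, 'm) vs_scheme"
  assumes "is_vs V" "finite_dim V"
  obtains B \<beta> where "finite B" "B \<subseteq> car V" "\<And>b. b \<in> B \<Longrightarrow> \<beta> b \<in> dual_space V"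
    "\<And>x. x \<in> car V \<Longrightarrow> x = (\<Sum>b\<in>B. scl V (\<beta> b x) b)"
proof -
  interpret vector_space "scl V" using assms(1) by (simp add: is_vs_def)
  obtain S where S: "finite S" "car V = span S" using assms(2) by (auto simp: finite_dim_def)
  obtain B where B: "B \<subseteq> S" "independent B" "S \<subseteq> span B"
    by (rule maximal_independent_subset)
  have fin: "finite B" using S(1) B(1) by (rule rev_finite_subset)
  have span: "span B = car V"
    using S(2) B(1,3) by (metis span_mono span_minimal subspace_span subset_antisym)
  define \<beta> where "\<beta> b x = representation B x b" for b x
  have "\<beta> b \<in> dual_space V" for b
    unfolding dual_space_def linear_on_def \<beta>_def
    by (auto simp: span[symmetric] representation_add[OF B(2)] representation_scale[OF B(2)])
      (simp add: representation_def)
  moreover have "x = (\<Sum>b\<in>B. scl V (\<beta> b x) b)" if "x \<in> car V" for x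
    unfolding \<beta>_def using sum_representation_eq[OF B(2) _ fin order_refl, of x] that span by simp
  moreover have "B \<subseteq> car V" using span span_base by blast
  ultimately show thesis using that fin by blast
qed

lemma linear_on_span:
  assumes "\<And>f. f \<in> F \<Longrightarrow> linear_on V ground f" "s \<in> fscale.span F"
  shows "linear_on V ground s"
proof -
  have "fscale.subspace {p. linear_on V ground p}"
    by (rule fscale.subspaceI) (auto simp: linear_on_def fun_apply fscale_def algebra_simps)
  then show ?thesis using fscale.span_minimal[of F "{p. linear_on V ground p}"] assms by auto
qed

text \<open>
  Induction on the number of functionals, for all spaces simultaneously: restricted to the
  kernel of \<open>f\<close>, the functional \<open>q\<close> is a combination \<open>s\<close> of the other ones, and \<open>q - s\<close>, which
  vanishes on the kernel of \<open>f\<close>, is a multiple of \<open>f\<close>.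
\<close>

lemma functional_in_span:
  fixes V :: "('k::field, 'v::ab_group_add, 'm) vs_scheme"
  assumes "finite F" "is_vs V" "\<And>f. f \<in> F \<Longrightarrow> linear_on V ground f" "linear_on V ground q"
    and "\<And>x. x \<in> car V \<Longrightarrow> \<forall>f\<in>F. f x = 0 \<Longrightarrow> q x = 0"
  shows "\<exists>s\<in>fscale.span F. \<forall>x\<in>car V. q x = s x"
  using assms
proof (induction F arbitrary: V rule: finite_induct)
  case empty
  then show ?case by (auto simp: fun_apply)
next
  case (insert f F)
  define V' where "V' = V\<lparr>car := {x \<in> car V. f x = 0}\<rparr>"
  interpret vector_space "scl V" using insert.prems(1) by (simp add: is_vs_def)
  have V: "\<And>x y. x \<in> car V \<Longrightarrow> y \<in> car V \<Longrightarrow> x + y \<in> car V"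
    "\<And>x a. x \<in> car V \<Longrightarrow> scl V a x \<in> car V" "0 \<in> car V"
    using is_vs_closed[OF insert.prems(1)] by auto
  have f: "linear_on V ground f" using insert.prems(2) by simp
  have f': "\<And>x y. x \<in> car V \<Longrightarrow> y \<in> car V \<Longrightarrow> f (x + y) = f x + f y"
    "\<And>x a. x \<in> car V \<Longrightarrow> f (scl V a x) = a * f x"
    using f by (auto simp: linear_on_def)
  have vs': "is_vs V'"
    using insert.prems(1) V f' linear_on_zero[OF insert.prems(1) f]
    by (auto simp: is_vs_def V'_def intro!: subspaceI)
  have lin': "linear_on V' ground g" if "linear_on V ground g" for g
    using that by (auto simp: V'_def linear_on_def)
  have "\<exists>s\<in>fscale.span F. \<forall>x\<in>car V'. q x = s x"
    using insert.prems(2,3,4) vs' lin' by (intro insert.IH) (auto simp: V'_def)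
  then obtain s where s: "s \<in> fscale.span F" "\<And>x. x \<in> car V \<Longrightarrow> f x = 0 \<Longrightarrow> q x = s x"
    by (auto simp: V'_def)
  have "s \<in> fscale.span (insert f F)" using s(1) fscale.span_mono[of F "insert f F"] by blast
  show ?case
  proof (cases "\<forall>w\<in>car V. f w = 0")
    case True
    then show ?thesis using s \<open>s \<in> fscale.span (insert f F)\<close> by blast
  next
    case False
    then obtain w where w: "w \<in> car V" "f w \<noteq> 0" by blast
    let ?s = "s + fscale ((q w - s w) / f w) f"
    have "linear_on V ground s" using linear_on_span[OF _ s(1)] insert.prems(2) by blast
    then have lin: "\<And>x y. x \<in> car V \<Longrightarrow> y \<in> car V \<Longrightarrow> s (x + y) = s x + s y"
      "\<And>x a. x \<in> car V \<Longrightarrow> s (scl V a x) = a * s x"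
      "\<And>x y. x \<in> car V \<Longrightarrow> y \<in> car V \<Longrightarrow> q (x + y) = q x + q y"
      "\<And>x a. x \<in> car V \<Longrightarrow> q (scl V a x) = a * q x"
      using insert.prems(3) by (auto simp: linear_on_def)
    have "q x = ?s x" if x: "x \<in> car V" for x
    proof -
      \<comment> \<open>The vector \<open>x + ?y\<close> is the projection of \<open>x\<close> to the kernel of \<open>f\<close> along \<open>w\<close>.\<close>
      let ?y = "scl V (- (f x / f w)) w"
      have "q (x + ?y) = s (x + ?y)"
        by (rule s(2)) (use x w V f' in \<open>auto simp del: scale_minus_left\<close>)
      then have "q x + - (f x / f w) * q w = s x + - (f x / f w) * s w"
        using x w(1) V lin by (simp del: scale_minus_left)
      then show ?thesis using w(2) by (simp add: fun_apply fscale_def field_simps)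
    qed
    moreover have "?s \<in> fscale.span (insert f F)"
      using \<open>s \<in> fscale.span (insert f F)\<close>
      by (intro fscale.span_add fscale.span_scale) (auto intro: fscale.span_base)
    ultimately show ?thesis by blast
  qed
qed

lemma dual_fin_dim:
  assumes "is_vs V" "finite_dim V"
  shows "\<exists>G. finite G \<and> dual_space V \<subseteq> fscale.span G"
proof -
  obtain B \<beta> where B: "finite B" "B \<subseteq> car V" "\<And>b. b \<in> B \<Longrightarrow> \<beta> b \<in> dual_space V"
    "\<And>x. x \<in> car V \<Longrightarrow> x = (\<Sum>b\<in>B. scl V (\<beta> b x) b)"
    using dual_basis[OF assms] by blast
  have "p \<in> fscale.span (\<beta> ` B)" if p: "p \<in> dual_space V" for p
  proof -
    have "\<exists>s\<in>fscale.span (\<beta> ` B). \<forall>x\<in>car V. p x = s x"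
    proof (rule functional_in_span[OF _ assms(1)])
      fix x assume x: "x \<in> car V" "\<forall>f\<in>\<beta> ` B. f x = 0"
      interpret vector_space "scl V" using assms(1) by (simp add: is_vs_def)
      have "x = 0" using B(4)[OF x(1)] x(2) by simp
      then show "p x = 0" using linear_on_zero[OF assms(1) dual_linear[OF p]] by simp
    qed (use B(1) dual_linear[OF B(3)] dual_linear[OF p] in auto)
    then obtain s where s: "s \<in> fscale.span (\<beta> ` B)" "\<forall>x\<in>car V. p x = s x" by blast
    moreover have "s \<in> dual_space V"
      using s(1) fscale.span_minimal[OF _ subspace_dual[of V], of "\<beta> ` B"] B(3) by blast
    ultimately show ?thesis using dual_eqI[OF p] by metis
  qed
  then show ?thesis using B(1) by blast
qed

text \<open>
  This is \<open>functional_in_span\<close> applied to a basis of \<open>J\<close>, which is finite because the dual space is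
  finite dimensional.
\<close>

lemma double_annihilator:
  assumes "is_vs V" "finite_dim V" "fscale.subspace J" "J \<subseteq> dual_space V" "q \<in> dual_space V"
    and "\<And>x. x \<in> car V \<Longrightarrow> \<forall>p\<in>J. p x = 0 \<Longrightarrow> q x = 0"
  shows "q \<in> J"
proof -
  obtain F where F: "F \<subseteq> J" "fscale.independent F" "J \<subseteq> fscale.span F"
    by (rule fscale.maximal_independent_subset)
  obtain G where G: "finite G" "dual_space V \<subseteq> fscale.span G"
    using dual_fin_dim[OF assms(1,2)] by blast
  have "finite F" using fscale.independent_span_bound[OF G(1) F(2)] F(1) assms(4) G(2) by blast
  have span: "fscale.span F = J"
    using F(1,3) fscale.span_minimal[OF F(1) assms(3)] by blast
  have "\<exists>s\<in>fscale.span F. \<forall>x\<in>car V. q x = s x"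
  proof (rule functional_in_span[OF \<open>finite F\<close> assms(1)])
    show "q x = 0" if x: "x \<in> car V" "\<forall>f\<in>F. f x = 0" for x
    proof (rule assms(6)[OF x(1)])
      have "fscale.subspace {p. p x = 0}"
        by (rule fscale.subspaceI) (auto simp: fun_apply fscale_def)
      then have "fscale.span F \<subseteq> {p. p x = 0}" using x(2) by (intro fscale.span_minimal) auto
      then show "\<forall>p\<in>J. p x = 0" using span by blast
    qed
  qed (use F(1) assms(4,5) dual_linear in auto)
  then show ?thesis using dual_eqI[OF assms(5)] assms(4) span by (metis subsetD)
qed

section \<open>The convolution algebra of a coalgebra\<close>

text \<open>
  A tensor is a functional on bilinear forms, so \<open>t (\<lambda>x y. p x * q y)\<close> is the value of \<open>p \<otimes> q\<close> at
  the tensor \<open>t\<close>. Only the values of a form on the carriers matter (\<open>tensor_cong\<close>), so it is harmless to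
  replace a linear map by its extension by zero, as the definitions of \<open>conv\<close> and \<open>conv_one\<close> do.
\<close>

lemma tensor_apply_not_bilinear:
  assumes "t \<in> car (tensor V W)" "\<not> bilinear_on V W ground A"
  shows "t A = 0"
  using assms(1)
  by (induction rule: tensor_linear_induct) (use assms(2) in \<open>auto simp: tens_def fun_apply fscale_def\<close>)

lemma tensor_cong:
  assumes "t \<in> car (tensor V W)" "is_vs V" "is_vs W"
    and eq: "\<And>x y. x \<in> car V \<Longrightarrow> y \<in> car W \<Longrightarrow> A x y = A' x y"
  shows "t A = t A'"
proof -
  have "bilinear_on V W ground A \<longleftrightarrow> bilinear_on V W ground A'"
    using is_vs_closed[OF assms(2)] is_vs_closed[OF assms(3)]
    by (simp add: bilinear_on_def linear_on_def eq)
  with assms(1) show ?thesis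
    by (induction rule: tensor_linear_induct) (auto simp: eq tens_def fun_apply fscale_def)
qed

lemma tensor_apply_sum:
  assumes t: "t \<in> car (tensor V W)" and bil: "\<And>i. i \<in> S \<Longrightarrow> bilinear_on V W ground (A i)"
  shows "t (\<lambda>x y. \<Sum>i\<in>S. a i * A i x y) = (\<Sum>i\<in>S. a i * t (A i))"
proof -
  have zero: "bilinear_on V W ground (\<lambda>x y. 0)" by (simp add: bilinear_on_def linear_on_def)
  have "bilinear_on V W ground (\<lambda>x y. \<Sum>i\<in>S. a i * A i x y) \<and>
      t (\<lambda>x y. \<Sum>i\<in>S. a i * A i x y) = (\<Sum>i\<in>S. a i * t (A i))"
    using bil
  proof (induction S rule: infinite_finite_induct)
    case (insert i S)
    have sc: "bilinear_on V W ground (\<lambda>x y. a i * A i x y)"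
      using insert.prems[of i] by (auto simp: bilinear_on_def linear_on_def algebra_simps)
    have "bilinear_on V W ground (\<lambda>x y. a i * A i x y + (\<Sum>i\<in>S. a i * A i x y))"
      using sc insert by (auto simp: bilinear_on_def linear_on_def algebra_simps)
    then show ?case
      using insert tensor_apply_linear(1)[OF t sc, of "\<lambda>x y. \<Sum>i\<in>S. a i * A i x y"]
        tensor_apply_linear(2)[OF t, of "A i" "A i" "a i"] by simp
  qed (use zero tensor_apply_linear(2)[OF t zero zero, of 0] in auto)
  then show ?thesis ..
qed

lemma bilinear_functionals:
  assumes "linear_on V ground p" "linear_on W ground q"
  shows "bilinear_on V W ground (\<lambda>x y. p x * q y)"
  using assms by (auto simp: bilinear_on_def linear_on_def algebra_simps)

context coalgebra
begin

abbreviation dual :: "('c \<Rightarrow> 'k) set" where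
  "dual \<equiv> dual_space C"

definition conv :: "('c \<Rightarrow> 'k) \<Rightarrow> ('c \<Rightarrow> 'k) \<Rightarrow> 'c \<Rightarrow> 'k" (infixl "\<star>" 70) where
  "p \<star> q = (\<lambda>c. if c \<in> car C then comult C c (\<lambda>x y. p x * q y) else 0)"

definition conv_one :: "'c \<Rightarrow> 'k" where
  "conv_one = (\<lambda>c. if c \<in> car C then counit C c else 0)"

lemma comult_in: "c \<in> car C \<Longrightarrow> comult C c \<in> car (tensor C C)"
  using comult_linear by (simp add: linear_on_def)

lemma linear_on_comult_apply: "linear_on C ground (\<lambda>c. comult C c A)"
  using comult_linear by (auto simp: linear_on_def fun_apply fscale_def)

lemma bilinear_dual: "p \<in> dual \<Longrightarrow> q \<in> dual \<Longrightarrow> bilinear_on C C ground (\<lambda>x y. p x * q y)"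
  by (intro bilinear_functionals dual_linear)

lemma restrict_dual:
  assumes "linear_on C ground f"
  shows "(\<lambda>c. if c \<in> car C then f c else 0) \<in> dual"
  using assms is_vs_closed[OF is_vs] by (auto simp: dual_space_def linear_on_def)

lemma conv_closed: "p \<star> q \<in> dual"
  unfolding conv_def by (rule restrict_dual) (rule linear_on_comult_apply)

lemma conv_one_closed: "conv_one \<in> dual"
  unfolding conv_one_def by (rule restrict_dual) (rule counit_linear)

lemma conv_one_left:
  assumes q: "q \<in> dual"
  shows "conv_one \<star> q = q"
proof (rule dual_eqI[OF conv_closed q])
  fix c assume c: "c \<in> car C"
  have bil: "bilinear_on ground C ground (\<lambda>a y. a * q y)"
    by (rule bilinear_functionals) (use dual_linear[OF q] in \<open>auto simp: linear_on_def\<close>)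
  have "(conv_one \<star> q) c = comult C c (\<lambda>x y. counit C x * q y)"
    unfolding conv_def using c
    by (auto intro!: tensor_cong[OF comult_in[OF c] is_vs is_vs] simp: conv_one_def)
  also have "\<dots> = tensor_map ground C (counit C) id (comult C c) (\<lambda>a y. a * q y)"
    using bil by (simp add: tensor_map_def)
  also have "\<dots> = q c" using bil by (simp add: counit_left[OF c] tens_def)
  finally show "(conv_one \<star> q) c = q c" .
qed

lemma conv_one_right:
  assumes q: "q \<in> dual"
  shows "q \<star> conv_one = q"
proof (rule dual_eqI[OF conv_closed q])
  fix c assume c: "c \<in> car C"
  have bil: "bilinear_on C ground ground (\<lambda>x a. q x * a)"
    by (rule bilinear_functionals) (use dual_linear[OF q] in \<open>auto simp: linear_on_def\<close>)
  have "(q \<star> conv_one) c = comult C c (\<lambda>x y. q x * counit C y)"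
    unfolding conv_def using c
    by (auto intro!: tensor_cong[OF comult_in[OF c] is_vs is_vs] simp: conv_one_def)
  also have "\<dots> = tensor_map C ground id (counit C) (comult C c) (\<lambda>x a. q x * a)"
    using bil by (simp add: tensor_map_def)
  also have "\<dots> = q c" using bil by (simp add: counit_right[OF c] tens_def)
  finally show "(q \<star> conv_one) c = q c" .
qed

text \<open>
  Coassociativity is evaluated at the form \<open>B x t = p(x) (q \<otimes> r)(t)\<close> on \<open>C \<times> (C \<otimes> C)\<close>, which represents
  \<open>p \<otimes> q \<otimes> r\<close>.
\<close>

lemma conv_assoc:
  assumes p: "p \<in> dual" and q: "q \<in> dual" and r: "r \<in> dual"
  shows "p \<star> q \<star> r = p \<star> (q \<star> r)"
proof (rule dual_eqI[OF conv_closed conv_closed])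
  fix c assume c: "c \<in> car C"
  let ?pq = "\<lambda>x y. p x * q y" and ?qr = "\<lambda>x y. q x * r y"
  define B where "B = (\<lambda>x t. p x * t ?qr)"
  have "linear_on (tensor C C) ground (\<lambda>t. t A)" for A
    by (auto simp: linear_on_def fun_apply fscale_def)
  then have bilB: "bilinear_on C (tensor C C) ground B"
    and bilG: "bilinear_on (tensor C C) C ground (\<lambda>s z. s ?pq * r z)"
    unfolding B_def by (auto intro!: bilinear_functionals dual_linear[OF p] dual_linear[OF r])
  have tens_qr: "tens C C y z ?qr = q y * r z" for y z
    using bilinear_dual[OF q r] by (simp add: tens_def)
  have G: "s (\<lambda>x y. B x (tens C C y z)) = s ?pq * r z" if "s \<in> car (tensor C C)" for s z
  proof -
    have "(\<lambda>x y. B x (tens C C y z)) = (\<lambda>x y. r z * ?pq x y)"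
      by (simp add: B_def tens_qr fun_eq_iff)
    then show ?thesis
      using tensor_apply_linear(2)[OF that bilinear_dual[OF p q] bilinear_dual[OF p q], of "r z"]
      by simp
  qed
  have bilG': "bilinear_on (tensor C C) C ground (\<lambda>s z. s (\<lambda>x y. B x (tens C C y z)))"
    using bilG is_vs_closed[OF is_vs_tensor[of C C]] by (simp add: bilinear_on_def linear_on_def G)
  have "(p \<star> q \<star> r) c = comult C c (\<lambda>s z. comult C s ?pq * r z)"
    unfolding conv_def using c by (auto intro!: tensor_cong[OF comult_in[OF c] is_vs is_vs])
  also have "\<dots> = comult C c (\<lambda>s z. comult C s (\<lambda>x y. B x (tens C C y z)))"
    by (rule tensor_cong[OF comult_in[OF c] is_vs is_vs]) (simp add: G comult_in)
  also have "\<dots> = tensor_assoc C C C (tensor_map (tensor C C) C (comult C) id (comult C c)) B"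
    using bilB bilG' by (simp add: tensor_assoc_def tensor_map_def)
  also have "\<dots> = tensor_map C (tensor C C) id (comult C) (comult C c) B"
    by (simp add: coassoc[OF c])
  also have "\<dots> = comult C c (\<lambda>x y. p x * comult C y ?qr)"
    using bilB by (simp add: tensor_map_def B_def)
  also have "\<dots> = (p \<star> (q \<star> r)) c"
    unfolding conv_def using c by (auto intro!: tensor_cong[OF comult_in[OF c] is_vs is_vs])
  finally show "(p \<star> q \<star> r) c = (p \<star> (q \<star> r)) c" .
qed

lemma conv_linear:
  assumes "p \<in> dual" "q \<in> dual" "r \<in> dual"
  shows "(p + q) \<star> r = p \<star> r + q \<star> r" "p \<star> (q + r) = p \<star> q + p \<star> r"
    "fscale a p \<star> q = fscale a (p \<star> q)" "p \<star> fscale a q = fscale a (p \<star> q)"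
proof -
  have L: "comult C c (\<lambda>x y. p x * r y + q x * r y)
      = comult C c (\<lambda>x y. p x * r y) + comult C c (\<lambda>x y. q x * r y)"
    "comult C c (\<lambda>x y. p x * q y + p x * r y)
      = comult C c (\<lambda>x y. p x * q y) + comult C c (\<lambda>x y. p x * r y)"
    "comult C c (\<lambda>x y. a * (p x * q y)) = a * comult C c (\<lambda>x y. p x * q y)"
    if "c \<in> car C" for c
    using assms by (auto intro!: tensor_apply_linear[OF comult_in[OF that]] bilinear_dual)
  show "(p + q) \<star> r = p \<star> r + q \<star> r" "p \<star> (q + r) = p \<star> q + p \<star> r"
    "fscale a p \<star> q = fscale a (p \<star> q)" "p \<star> fscale a q = fscale a (p \<star> q)"
    using L by (auto simp: conv_def fun_eq_iff fun_apply fscale_def algebra_simps)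
qed

text \<open>
  A functional \<open>p\<close> acts on \<open>C\<close> by \<open>T p c = (p \<otimes> id)(\<Delta> c)\<close>. In terms of a basis \<open>B\<close> with dual basis
  \<open>\<beta>\<close>, this gives \<open>\<Delta> c = (\<Sum>b\<in>B. b \<otimes> T (\<beta> b) c)\<close>, so a subspace stable under all \<open>T p\<close> is
  a left subcomodule. The zero set of the left ideal generated by \<open>a\<close> is stable because
  \<open>q(T p c) = (p \<star> q)(c)\<close>.
\<close>

lemma annihilator_left_subcomodule:
  assumes fin: "finite_dim C" and a: "a \<in> dual"
  shows "left_subcomodule C {c \<in> car C. \<forall>p\<in>dual. (p \<star> a) c = 0}" (is "left_subcomodule C ?N")
proof -
  interpret vector_space "scl C" using is_vs by (simp add: is_vs_def)
  obtain B \<beta> where B: "finite B" "B \<subseteq> car C" "\<And>b. b \<in> B \<Longrightarrow> \<beta> b \<in> dual"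
    "\<And>x. x \<in> car C \<Longrightarrow> x = (\<Sum>b\<in>B. scl C (\<beta> b x) b)"
    using dual_basis[OF is_vs fin] by blast
  have expand: "q x = (\<Sum>b\<in>B. \<beta> b x * q b)" if "linear_on C ground q" "x \<in> car C" for q x
  proof -
    have "q x = q (\<Sum>b\<in>B. scl C (\<beta> b x) b)" using B(4)[OF that(2)] by simp
    also have "\<dots> = (\<Sum>b\<in>B. q (scl C (\<beta> b x) b))"
      using that(1) is_vs_closed(2)[OF is_vs] B(1,2) by (intro linear_on_sum[OF is_vs]) auto
    also have "\<dots> = (\<Sum>b\<in>B. \<beta> b x * q b)"
      using that(1) B(2) by (intro sum.cong) (auto simp: linear_on_def)
    finally show ?thesis .
  qed
  define T where "T p c = (\<Sum>b\<in>B. scl C ((p \<star> \<beta> b) c) b)" for p c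
  have T_in: "T p c \<in> car C" for p c
    unfolding T_def using B(2) is_vs is_vs_closed(2)[OF is_vs]
    by (intro subspace_sum) (auto simp: is_vs_def)
  have T: "q (T p c) = (p \<star> q) c" if "p \<in> dual" "q \<in> dual" "c \<in> car C" for p q c
  proof -
    have "q (T p c) = (\<Sum>b\<in>B. q (scl C ((p \<star> \<beta> b) c) b))"
      unfolding T_def using that(2) is_vs_closed(2)[OF is_vs] B(1,2) dual_linear
      by (intro linear_on_sum[OF is_vs]) auto
    also have "\<dots> = (\<Sum>b\<in>B. q b * (p \<star> \<beta> b) c)"
      using dual_linear[OF that(2)] B(2) by (intro sum.cong) (auto simp: linear_on_def)
    also have "\<dots> = comult C c (\<lambda>x y. \<Sum>b\<in>B. q b * (p x * \<beta> b y))"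
      unfolding conv_def using that B(3)
      by (simp add: tensor_apply_sum[OF comult_in] bilinear_dual)
    also have "\<dots> = comult C c (\<lambda>x y. p x * q y)"
      using that by (intro tensor_cong[OF comult_in is_vs is_vs])
        (auto simp: expand[OF dual_linear] sum_distrib_left algebra_simps)
    finally show ?thesis using that(3) by (simp add: conv_def)
  qed
  have T_N: "T p c \<in> ?N" if "p \<in> dual" "c \<in> ?N" for p c
    using that a T_in by (auto simp: T conv_closed conv_assoc[symmetric])
  have comult_eq: "comult C c = (\<Sum>b\<in>B. tens C C b (T (\<beta> b) c))" if c: "c \<in> car C" for c
  proof
    fix A
    have sum_apply: "(\<Sum>b\<in>B. tens C C b (T (\<beta> b) c)) A = (\<Sum>b\<in>B. tens C C b (T (\<beta> b) c) A)"
      by (induction B rule: infinite_finite_induct) (auto simp: fun_apply)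
    show "comult C c A = (\<Sum>b\<in>B. tens C C b (T (\<beta> b) c)) A"
    proof (cases "bilinear_on C C ground A")
      case False
      then show ?thesis
        using tensor_apply_not_bilinear[OF comult_in[OF c]] unfolding sum_apply by (simp add: tens_def)
    next
      case True
      have lin: "linear_on C ground (A b)" if "b \<in> B" for b
        using True that B(2) by (auto simp: bilinear_on_def)
      have lin': "linear_on C ground (\<lambda>x. A x y)" if "y \<in> car C" for y
        using True that by (auto simp: bilinear_on_def)
      \<comment> \<open>The factor 1 is the coefficient required by \<open>tensor_apply_sum\<close>.\<close>
      have "A b (T (\<beta> b) c) = 1 * comult C c (\<lambda>x y. \<beta> b x * A b y)" if b: "b \<in> B" for b
      proof -
        let ?q = "\<lambda>y. if y \<in> car C then A b y else 0"
        have "A b (T (\<beta> b) c) = (\<beta> b \<star> ?q) c"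
          using T[OF B(3)[OF b] restrict_dual[OF lin[OF b]] c] T_in by simp
        also have "\<dots> = comult C c (\<lambda>x y. \<beta> b x * A b y)"
          unfolding conv_def using c by (auto intro!: tensor_cong[OF comult_in[OF c] is_vs is_vs])
        finally show ?thesis by simp
      qed
      then have "(\<Sum>b\<in>B. A b (T (\<beta> b) c)) = (\<Sum>b\<in>B. 1 * comult C c (\<lambda>x y. \<beta> b x * A b y))"
        by simp
      also have "\<dots> = comult C c (\<lambda>x y. \<Sum>b\<in>B. 1 * (\<beta> b x * A b y))"
        using dual_linear[OF B(3)] lin
        by (intro tensor_apply_sum[OF comult_in[OF c], symmetric] bilinear_functionals) auto
      also have "\<dots> = comult C c A"
        by (intro tensor_cong[OF comult_in[OF c] is_vs is_vs]) (simp add: expand[OF lin'])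
      finally show ?thesis using True unfolding sum_apply by (simp add: tens_def)
    qed
  qed
  have "subspace ?N"
    using is_vs_closed[OF is_vs] linear_on_zero[OF is_vs dual_linear[OF conv_closed]]
      dual_linear[OF conv_closed]
    by (intro subspaceI) (auto simp: linear_on_def)
  moreover have "comult C c \<in> fscale.span {tens C C x y | x y. x \<in> car C \<and> y \<in> ?N}"
    if c: "c \<in> ?N" for c
  proof -
    have "c \<in> car C" using c by simp
    show ?thesis
      unfolding comult_eq[OF \<open>c \<in> car C\<close>]
      by (intro fscale.span_sum fscale.span_base) (use T_N[OF B(3) c] B(2) in blast)
  qed
  ultimately show ?thesis unfolding left_subcomodule_def by blast
qed

end

lemma dual_algebra:
  fixes D :: "('l::alg_closed_field, 'd::ab_group_add) coalg"
  assumes "coalgebra D" "finite_dim D"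
  shows "fin_dim_algebra fscale (dual_space D) (coalgebra.conv D) (coalgebra.conv_one D)"
proof -
  interpret D: coalgebra D by fact
  show ?thesis
    by unfold_locales
      (use subspace_dual dual_fin_dim[OF D.is_vs assms(2)] in
        \<open>auto simp: D.conv_closed D.conv_one_closed D.conv_assoc D.conv_one_left D.conv_one_right
          D.conv_linear\<close>)
qed

context coalgebra
begin

text \<open>
  The functional \<open>b = \<epsilon> \<star> b\<close> vanishes on the common zeros of the left ideal generated by \<open>b\<close>, hence on those
  of the left ideal generated by \<open>a\<close>, so it belongs to the latter by \<open>double_annihilator\<close>.
\<close>

lemma left_divides_of_annihilator_subset:
  assumes fin: "finite_dim C" and a: "a \<in> dual" and b: "b \<in> dual"
    and sub: "{c \<in> car C. \<forall>p\<in>dual. (p \<star> a) c = 0} \<subseteq> {c \<in> car C. \<forall>p\<in>dual. (p \<star> b) c = 0}"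
  shows "\<exists>r\<in>dual. b = r \<star> a"
proof -
  let ?J = "(\<lambda>p. p \<star> a) ` dual"
  have "b \<in> ?J"
  proof (rule double_annihilator[OF is_vs fin])
    show "fscale.subspace ?J"
    proof (rule fscale.subspaceI)
      have "0 \<star> a = 0"
        using conv_linear(3)[of a a a 0] a by simp
      then show "0 \<in> ?J" using fscale.subspace_0[OF subspace_dual] by (metis image_eqI)
      fix q assume "q \<in> ?J"
      then obtain p where p: "p \<in> dual" "q = p \<star> a" by blast
      show "fscale t q \<in> ?J" for t
        using p a fscale.subspace_scale[OF subspace_dual] by (auto simp flip: conv_linear(3))
      fix q' assume "q' \<in> ?J"
      then obtain p' where p': "p' \<in> dual" "q' = p' \<star> a" by blast
      show "q + q' \<in> ?J"
        using p p' a fscale.subspace_add[OF subspace_dual] by (auto simp flip: conv_linear(1))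
    qed
    show "b c = 0" if c: "c \<in> car C" "\<forall>q\<in>?J. q c = 0" for c
    proof -
      have "(conv_one \<star> b) c = 0" using sub c conv_one_closed by blast
      then show ?thesis by (simp add: conv_one_left[OF b])
    qed
  qed (use b conv_closed in auto)
  then show ?thesis by blast
qed

end

lemma (in chain_coalgebra) dual_left_chain:
  assumes "finite_dim C" "a \<in> dual" "b \<in> dual"
  shows "(\<exists>r\<in>dual. b = r \<star> a) \<or> (\<exists>r\<in>dual. a = r \<star> b)"
  using chain[OF annihilator_left_subcomodule[OF assms(1,2)] annihilator_left_subcomodule[OF assms(1,3)]]
    left_divides_of_annihilator_subset[OF assms] left_divides_of_annihilator_subset[OF assms(1,3,2)]
  by blast

section \<open>Coordinates given by a basis of the dual\<close>

lemma fscale_sum_apply: "(\<Sum>i\<in>S. fscale (f i) (u i)) c = (\<Sum>i\<in>S. f i * u i c)"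
  by (induction S rule: infinite_finite_induct) (auto simp: fun_apply fscale_def)

text \<open>
  Injectivity holds because the \<open>p i\<close> span the dual, which separates points. For surjectivity, \<open>p k\<close>
  is not in the span of the other \<open>p i\<close>, so by \<open>double_annihilator\<close> some vector is annihilated by
  these but not by \<open>p k\<close>; suitably scaled, these vectors form a dual basis.
\<close>

lemma dual_coordinates_bij:
  fixes V :: "('k::field, 'v::ab_group_add, 'm) vs_scheme" and m :: nat
  assumes V: "is_vs V" "finite_dim V" and p: "\<And>i. i < m \<Longrightarrow> p i \<in> dual_space V"
    and ind: "\<And>f. (\<Sum>i<m. fscale (f i) (p i)) = 0 \<Longrightarrow> \<forall>i<m. f i = 0"
    and span: "\<And>q. q \<in> dual_space V \<Longrightarrow> \<exists>f. q = (\<Sum>i<m. fscale (f i) (p i))"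
  shows "bij_betw (\<lambda>c i. if i < m then p i c else 0) (car V) {f. \<forall>i\<ge>m. f i = 0}"
proof -
  let ?f = "\<lambda>c i. if i < m then p i c else 0"
  interpret vector_space "scl V" using V by (simp add: is_vs_def)
  have "inj_on ?f (car V)"
  proof (rule inj_onI, rule ccontr)
    fix x y assume xy: "x \<in> car V" "y \<in> car V" "?f x = ?f y" "x \<noteq> y"
    obtain q where q: "linear_on V ground q" "q x \<noteq> q y" using vs_separate[OF V(1) xy(4)] by blast
    let ?q = "\<lambda>x. if x \<in> car V then q x else 0"
    have "?q \<in> dual_space V"
      using q(1) is_vs_closed[OF V(1)] by (auto simp: dual_space_def linear_on_def)
    then obtain f where f: "?q = (\<Sum>i<m. fscale (f i) (p i))" using span by blast
    have f_apply: "?q z = (\<Sum>i<m. f i * p i z)" for z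
      using fun_cong[OF f, of z] by (simp add: fscale_sum_apply)
    have "p i x = p i y" if "i < m" for i using fun_cong[OF xy(3), of i] that by simp
    then have "?q x = ?q y" unfolding f_apply by simp
    then show False using q(2) xy(1,2) by simp
  qed
  moreover have "g \<in> ?f ` car V" if g: "\<forall>i\<ge>m. g i = 0" for g
  proof -
    have "\<exists>c\<in>car V. p k c = 1 \<and> (\<forall>i<m. i \<noteq> k \<longrightarrow> p i c = 0)" if k: "k < m" for k
    proof -
      let ?J = "range (\<lambda>f. \<Sum>i\<in>{..<m} - {k}. fscale (f i) (p i))"
      have "p k \<notin> ?J"
      proof
        assume "p k \<in> ?J"
        then obtain f where f: "p k = (\<Sum>i\<in>{..<m} - {k}. fscale (f i) (p i))" by blast
        \<comment> \<open>A representation of \<open>p k\<close> by the others is a relation with coefficient \<open>-1\<close> at \<open>k\<close>.\<close>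
        have "(\<Sum>i<m. fscale ((f(k := - 1)) i) (p i))
            = fscale (- 1) (p k) + (\<Sum>i\<in>{..<m} - {k}. fscale ((f(k := - 1)) i) (p i))"
          using k by (subst sum.remove[of _ k]) auto
        also have "\<dots> = 0" using f by simp
        finally have "(f(k := - 1)) k = 0" using ind k by blast
        then show False by simp
      qed
      moreover have "fscale.subspace ?J"
      proof (rule fscale.subspaceI)
        show "0 \<in> ?J" by (rule range_eqI[of _ _ "\<lambda>_. 0"]) simp
        fix q assume "q \<in> ?J"
        then obtain f where f: "q = (\<Sum>i\<in>{..<m} - {k}. fscale (f i) (p i))" by blast
        show "fscale a q \<in> ?J" for a
          unfolding f fscale.scale_sum_right fscale.scale_scale by (rule rangeI)
        fix q' assume "q' \<in> ?J"
        then obtain f' where f': "q' = (\<Sum>i\<in>{..<m} - {k}. fscale (f' i) (p i))" by blast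
        show "q + q' \<in> ?J"
          unfolding f f' sum.distrib[symmetric] fscale.scale_left_distrib[symmetric]
          by (rule rangeI)
      qed
      moreover have "?J \<subseteq> dual_space V"
        using p by (auto intro!: fscale.subspace_sum[OF subspace_dual]
            fscale.subspace_scale[OF subspace_dual])
      ultimately obtain c where c: "c \<in> car V" "\<forall>q\<in>?J. q c = 0" "p k c \<noteq> 0"
        using double_annihilator[OF V _ _ p[OF k]] by blast
      have "p i c = 0" if "i < m" "i \<noteq> k" for i
      proof -
        have "(\<Sum>j\<in>{..<m} - {k}. fscale (if j = i then 1 else 0) (p j))
            = (\<Sum>j\<in>{..<m} - {k}. if j = i then p i else 0)"
          by (intro sum.cong) auto
        also have "\<dots> = p i" using that by simp
        finally have "p i = (\<Sum>j\<in>{..<m} - {k}. fscale (if j = i then 1 else 0) (p j))" by (rule sym)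
        then have "p i \<in> ?J" by (rule range_eqI[of _ _ "\<lambda>j. if j = i then 1 else 0"])
        then show ?thesis using c(2) by (rule bspec[rotated])
      qed
      moreover have "p i (scl V a c) = a * p i c" if "i < m" for i a
        using dual_linear[OF p[OF that]] c(1) by (simp add: linear_on_def)
      ultimately show ?thesis
        using c(1,3) k is_vs_closed(2)[OF V(1) c(1)]
        by (intro bexI[of _ "scl V (inverse (p k c)) c"]) auto
    qed
    then have "\<exists>d. \<forall>k<m. d k \<in> car V \<and> p k (d k) = 1 \<and> (\<forall>i<m. i \<noteq> k \<longrightarrow> p i (d k) = 0)"
      by (intro choice) blast
    then obtain d where d: "\<And>k. k < m \<Longrightarrow> d k \<in> car V" "\<And>k. k < m \<Longrightarrow> p k (d k) = 1"
      "\<And>k i. k < m \<Longrightarrow> i < m \<Longrightarrow> i \<noteq> k \<Longrightarrow> p i (d k) = 0"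
      by blast
    define c where "c = (\<Sum>k<m. scl V (g k) (d k))"
    have "c \<in> car V"
      unfolding c_def using d(1) is_vs_closed(2)[OF V(1)] V(1)
      by (intro subspace_sum) (auto simp: is_vs_def)
    moreover have "p i c = g i" if "i < m" for i
    proof -
      have "p i c = (\<Sum>k<m. p i (scl V (g k) (d k)))"
        unfolding c_def using d(1) is_vs_closed(2)[OF V(1)] dual_linear[OF p[OF that]]
        by (intro linear_on_sum[OF V(1)]) auto
      also have "\<dots> = (\<Sum>k<m. if k = i then g i else 0)"
        using d that dual_linear[OF p[OF that]] by (intro sum.cong) (auto simp: linear_on_def)
      finally show ?thesis using that by simp
    qed
    then have "g = ?f c" using g by (auto simp: fun_eq_iff)
    ultimately show ?thesis by blast
  qed
  ultimately show ?thesis by (auto simp: bij_betw_def)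
qed

lemma bilinear_expand:
  assumes bil: "bilinear_on (K_coalg m) (K_coalg m) ground A"
    and "f \<in> car (K_coalg m)" "g \<in> car (K_coalg m)"
  shows "A f g = (\<Sum>i<m. \<Sum>j<m. f i * g j * A (cvec i) (cvec j))"
proof -
  have "is_vs (K_coalg m :: ('a, nat \<Rightarrow> 'a) coalg)"
    using coalgebra.is_vs[OF coalgebra_K_coalg] .
  note vs = this is_vs_closed(2)[OF this]
  have ex: "L f = (\<Sum>i<m. f i * L (cvec i))"
    if L: "linear_on (K_coalg m) ground L" and f: "f \<in> car (K_coalg m)" for L and f :: "nat \<Rightarrow> 'a"
  proof -
    have "f = (\<Sum>k<m. fscale (f k) (cvec k))" using f by (auto simp: fun_eq_iff sum_cvec)
    then have "L f = L (\<Sum>k<m. fscale (f k) (cvec k))" by simp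
    also have "\<dots> = (\<Sum>k<m. L (fscale (f k) (cvec k)))"
      using vs(2)[OF cvec_in_K] by (intro linear_on_sum[OF vs(1) L]) (auto simp del: K_coalg_simps(1) simp: K_coalg_simps(2))
    also have "\<dots> = (\<Sum>k<m. f k * L (cvec k))"
      using L by (intro sum.cong) (auto simp: linear_on_def cvec_in_K simp del: K_coalg_simps(1))
    finally show ?thesis .
  qed
  have "A f g = (\<Sum>i<m. f i * A (cvec i) g)"
    using ex[of "\<lambda>f. A f g"] bil assms(2,3) by (simp add: bilinear_on_def)
  also have "\<dots> = (\<Sum>i<m. f i * (\<Sum>j<m. g j * A (cvec i) (cvec j)))"
  proof (intro sum.cong refl)
    fix i assume "i \<in> {..<m}"
    then have "linear_on (K_coalg m) ground (A (cvec i))"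
      using bil cvec_in_K[of i m] unfolding bilinear_on_def by blast
    then show "f i * A (cvec i) g = f i * (\<Sum>j<m. g j * A (cvec i) (cvec j))"
      using ex[of "A (cvec i)" g] assms(3) by simp
  qed
  finally show ?thesis by (simp add: sum_distrib_left mult.assoc)
qed

lemma K_comult_apply:
  assumes "bilinear_on (K_coalg m) (K_coalg m) ground A"
  shows "comult (K_coalg m) f A = (\<Sum>k<m. f k * (\<Sum>(i, j) \<in> {(i, j). i + j = k}. A (cvec i) (cvec j)))"
proof -
  have sum_apply: "(\<Sum>x\<in>S. F x) A = (\<Sum>x\<in>S. F x A)" for S and F :: "'x \<Rightarrow> ((nat \<Rightarrow> 'a) \<Rightarrow> (nat \<Rightarrow> 'a) \<Rightarrow> 'a) \<Rightarrow> 'a"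
    by (induction S rule: infinite_finite_induct) (auto simp: fun_apply)
  have "tens (K_vs m) (K_vs m) x y A = A x y" for x y
    using assms by (simp add: tens_def bilinear_on_def linear_on_def)
  then show ?thesis
    by (simp add: K_coalg_def sum_apply fscale_sum_apply case_prod_unfold)
qed

section \<open>Finite dimensional chain coalgebras\<close>

theorem lemma2p8:
  fixes C :: "('k::alg_closed_field, 'c::ab_group_add) coalg"
  assumes "chain_coalgebra C" and "finite_dim C"
  shows "\<exists>n. coalgebra_isomorphic C (K_coalg n)"
proof -
  interpret chain_coalgebra C by fact
  interpret D: fin_dim_algebra fscale dual conv conv_one
    using dual_algebra coalgebra_axioms assms(2) by blast
  obtain x m where x: "x \<in> dual" "D.pow x m = 0"
    and ind: "\<And>f. (\<Sum>i<m. fscale (f i) (D.pow x i)) = 0 \<Longrightarrow> \<forall>i<m. f i = 0"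
    and span: "\<And>q. q \<in> dual \<Longrightarrow> \<exists>f. q = (\<Sum>i<m. fscale (f i) (D.pow x i))"
    using D.left_chain_truncated_polynomial[OF dual_left_chain[OF assms(2)]] by blast
  let ?p = "D.pow x"
  have p: "?p i \<in> dual" for i using x(1) by simp
  define f where "f c = (\<lambda>i. if i < m then ?p i c else 0)" for c
  have f_in: "f c \<in> car (K_coalg m)" for c by (simp add: f_def)
  have lin: "linear_on C (K_coalg m) f"
    using dual_linear[OF p] f_in
    by (auto simp: linear_on_def f_def fun_eq_iff fun_apply fscale_def)
  have bij: "bij_betw f (car C) (car (K_coalg m))"
    unfolding f_def K_coalg_simps by (rule dual_coordinates_bij[OF is_vs assms(2) p ind span])
  have counit: "counit (K_coalg m) (f c) = counit C c" if c: "c \<in> car C" for c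
  proof -
    have "counit (K_coalg m) (f c) = (\<Sum>k<m. if k = 0 then ?p 0 c else 0)"
      unfolding K_coalg_def coalg.simps by (intro sum.cong) (auto simp: f_def)
    \<comment> \<open>If \<open>m = 0\<close>, the sum is empty, and \<open>?p 0 = 0\<close> by the choice of \<open>m\<close>.\<close>
    also have "\<dots> = ?p 0 c" using x(2) by (cases m) (auto simp: fun_apply simp del: D.pow.simps)
    finally show ?thesis using c by simp (simp add: conv_one_def)
  qed
  have comult: "comult (K_coalg m) (f c) = tensor_map (K_coalg m) (K_coalg m) f f (comult C c)"
    if c: "c \<in> car C" for c
  proof
    fix A
    show "comult (K_coalg m) (f c) A = tensor_map (K_coalg m) (K_coalg m) f f (comult C c) A"
    proof (cases "bilinear_on (K_coalg m) (K_coalg m) ground A")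
      case False
      then have "comult (K_coalg m) (f c) A = 0"
        using tensor_apply_not_bilinear coalgebra.comult_in[OF coalgebra_K_coalg f_in] by blast
      then show ?thesis using False by (simp add: tensor_map_def)
    next
      case True
      let ?A = "\<lambda>i j. A (cvec i) (cvec j)"
      let ?S = "{..<m} \<times> {..<m}"
      \<comment> \<open>Expand the form in the coordinates \<open>?p i\<close>, so that \<open>\<Delta> c\<close> is evaluated only at products of functionals.\<close>
      have "A (f u) (f v) = (\<Sum>(i, j)\<in>?S. ?A i j * (?p i u * ?p j v))" for u v
      proof -
        have "A (f u) (f v) = (\<Sum>i<m. \<Sum>j<m. f u i * f v j * ?A i j)"
          by (rule bilinear_expand[OF True f_in f_in])
        also have "\<dots> = (\<Sum>i<m. \<Sum>j<m. ?A i j * (?p i u * ?p j v))"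
          by (intro sum.cong) (auto simp: f_def)
        finally show ?thesis by (simp add: sum.cartesian_product)
      qed
      then have "tensor_map (K_coalg m) (K_coalg m) f f (comult C c) A
          = comult C c (\<lambda>u v. \<Sum>s\<in>?S. ?A (fst s) (snd s) * (?p (fst s) u * ?p (snd s) v))"
        using True by (simp add: tensor_map_def case_prod_unfold)
      also have "\<dots> = (\<Sum>s\<in>?S. ?A (fst s) (snd s) * comult C c (\<lambda>u v. ?p (fst s) u * ?p (snd s) v))"
        by (intro tensor_apply_sum[OF comult_in[OF c]] bilinear_dual p)
      also have "\<dots> = (\<Sum>s\<in>?S. ?A (fst s) (snd s) * ?p (fst s + snd s) c)"
        using c by (simp add: D.pow_add[OF x(1)]) (simp add: conv_def)
      \<comment> \<open>By \<open>?p k = 0\<close> for \<open>k \<ge> m\<close>, only pairs with \<open>i + j < m\<close> contribute, as in \<open>K_coalg m\<close>.\<close>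
      also have "\<dots> = (\<Sum>s\<in>{s \<in> ?S. fst s + snd s < m}. ?A (fst s) (snd s) * ?p (fst s + snd s) c)"
        using D.pow_ge_zero[OF x] by (intro sum.mono_neutral_right) (auto simp: fun_apply not_less)
      also have "\<dots> = (\<Sum>(k, s)\<in>Sigma {..<m} (\<lambda>k. {(i, j). i + j = k}). ?A (fst s) (snd s) * ?p k c)"
        by (rule sum.reindex_bij_witness[of _ snd "\<lambda>s. (fst s + snd s, s)"]) auto
      also have "\<dots> = (\<Sum>k<m. \<Sum>s\<in>{(i, j). i + j = k}. ?A (fst s) (snd s) * ?p k c)"
        by (rule sum.Sigma[symmetric]) (auto simp: finite_pairs)
      also have "\<dots> = comult (K_coalg m) (f c) A"
        unfolding K_comult_apply[OF True]
        by (intro sum.cong) (auto simp: f_def sum_distrib_left case_prod_unfold mult.commute)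
      finally show ?thesis by simp
    qed
  qed
  show ?thesis
    unfolding coalgebra_isomorphic_def coalgebra_iso_def using lin bij comult counit by blast
qed

end
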